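(* Let $\Gamma$ be an infinite finitely generated amenable group, and let $S\subseteq\Gamma$ be a finite symmetric generating set with $e\in S$. Then there are finite sets $F_n\subseteq\Gamma$ with $e\in F_n$ such that $$\frac{|F_nSF_n^{-1}|}{|F_n|^2}\longrightarrow 0\qquad(n\to\infty).$$ In particular, $\Gamma$ has fixed price one.
   Context: For subsets $A,B,C$ of a group, $ABC=\{abc: a\in A,b\in B,c\in C\}$ and $A^{-1}=\{a^{-1}:a\in A\}$; symmetric means $S=S^{-1}$. Cost. Let $(X,\mu)$ be a standard probability space and $\mathcal R$ a countable probability-measure-preserving (pmp) equivalence relation on $X$. A graphing of $\mathcal R$ is a countable family $\Phi=\{\varphi_i:A_i\to B_i\}_{i\in I}$ of measure-preserving Borel isomorphisms between Borel subsets of $X$ with $(x,\varphi_i(x))\in\mathcal R$ for all $i\in I$, $x\in A_i$. It defines a graph on $X$ by joining $x$ to $\varphi_i(x)$; $\Phi$ generates $\mathcal R$ if, on a conull subset of $X$, the connected components of this graph are precisely the $\mathcal R$-classes. Put $\operatorname{cost}(\Phi)=\sum_{i}\mu(A_i)$ and $\operatorname{cost}(\mathcal R)=\inf\{\operatorname{cost}(\Phi):\Phi \text{ is a graphing that generates }\mathcal R\}$. For an essentially free pmp action $\Gamma\curvearrowright(X,\mu)$ of a countable group, $\operatorname{cost}(\Gamma\curvearrowright X)$ is the cost of its orbit equivalence relation. A countable group has fixed price one if every essentially free pmp action of it (on a standard probability space) has cost $1$. *)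

theory Defs
  imports
    "HOL-Probability.Probability_Measure"
    "HOL-Algebra.Group_Action"
    "HOL-Algebra.Generated_Groups"
begin

section \<open>Standard probability spaces\<close>

definition standard_borel_space :: "'x measure \<Rightarrow> bool" where
  "standard_borel_space M \<longleftrightarrow>
     (\<exists>T. topspace T = space M \<and> completely_metrizable_space T \<and> second_countable T \<and>
          sets M = sigma_sets (space M) {U. openin T U})"

definition standard_prob_space :: "'x measure \<Rightarrow> bool" where
  "standard_prob_space M \<longleftrightarrow> prob_space M \<and> standard_borel_space M"

section \<open>Graphings and cost\<close>

definition measure_preserving_iso ::
    "'x measure \<Rightarrow> 'x set \<Rightarrow> 'x set \<Rightarrow> ('x \<Rightarrow> 'x) \<Rightarrow> bool" where
  "measure_preserving_iso M A B f \<longleftrightarrow>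
     A \<in> sets M \<and> B \<in> sets M \<and> bij_betw f A B \<and>
     f \<in> measurable (restrict_space M A) (restrict_space M B) \<and>
     inv_into A f \<in> measurable (restrict_space M B) (restrict_space M A) \<and>
     distr (restrict_space M A) (restrict_space M B) f = restrict_space M B"

text \<open>A countable family of partial maps is indexed by a set of natural numbers; every countable
  index set is in bijection with such a set. Only the values of \<open>pmap \<Phi> i\<close> on \<open>source \<Phi> i\<close> matter.\<close>

record 'x partial_map_family =
  index :: "nat set"
  source :: "nat \<Rightarrow> 'x set"
  target :: "nat \<Rightarrow> 'x set"
  pmap :: "nat \<Rightarrow> 'x \<Rightarrow> 'x"

definition graphing ::
    "'x measure \<Rightarrow> ('x \<times> 'x) set \<Rightarrow> 'x partial_map_family \<Rightarrow> bool" where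
  "graphing M R \<Phi> \<longleftrightarrow>
     (\<forall>i\<in>index \<Phi>. measure_preserving_iso M (source \<Phi> i) (target \<Phi> i) (pmap \<Phi> i) \<and>
                   (\<forall>x\<in>source \<Phi> i. (x, pmap \<Phi> i x) \<in> R))"

definition graphing_edges :: "'x partial_map_family \<Rightarrow> ('x \<times> 'x) set" where
  "graphing_edges \<Phi> = {(x, pmap \<Phi> i x) | i x. i \<in> index \<Phi> \<and> x \<in> source \<Phi> i}"

definition graphing_component :: "'x partial_map_family \<Rightarrow> 'x \<Rightarrow> 'x set" where
  "graphing_component \<Phi> x = (graphing_edges \<Phi> \<union> (graphing_edges \<Phi>)\<inverse>)\<^sup>* `` {x}"

definition generates ::
    "'x measure \<Rightarrow> ('x \<times> 'x) set \<Rightarrow> 'x partial_map_family \<Rightarrow> bool" where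
  "generates M R \<Phi> \<longleftrightarrow> (AE x in M. graphing_component \<Phi> x = R `` {x})"

definition graphing_cost :: "'x measure \<Rightarrow> 'x partial_map_family \<Rightarrow> ennreal" where
  "graphing_cost M \<Phi> = (\<Sum>\<^sub>\<infinity>i\<in>index \<Phi>. emeasure M (source \<Phi> i))"

text \<open>The cost is meant for countable measure-preserving equivalence relations. It is only applied
  below to orbit relations of measure-preserving actions of countable groups, which are of this
  kind.\<close>

definition cost :: "'x measure \<Rightarrow> ('x \<times> 'x) set \<Rightarrow> ennreal" where
  "cost M R = Inf {graphing_cost M \<Phi> | \<Phi>. graphing M R \<Phi> \<and> generates M R \<Phi>}"

section \<open>Group actions and fixed price\<close>

definition pmp_action ::
    "('g, 'b) monoid_scheme \<Rightarrow> 'x measure \<Rightarrow> ('g \<Rightarrow> 'x \<Rightarrow> 'x) \<Rightarrow> bool" where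
  "pmp_action G M \<phi> \<longleftrightarrow>
     group_action G (space M) \<phi> \<and>
     (\<forall>g\<in>carrier G. \<phi> g \<in> measurable M M \<and> distr M M (\<phi> g) = M)"

definition essentially_free ::
    "('g, 'b) monoid_scheme \<Rightarrow> 'x measure \<Rightarrow> ('g \<Rightarrow> 'x \<Rightarrow> 'x) \<Rightarrow> bool" where
  "essentially_free G M \<phi> \<longleftrightarrow> (AE x in M. stabilizer G \<phi> x = {\<one>\<^bsub>G\<^esub>})"

definition orbit_relation ::
    "('g, 'b) monoid_scheme \<Rightarrow> 'x measure \<Rightarrow> ('g \<Rightarrow> 'x \<Rightarrow> 'x) \<Rightarrow> ('x \<times> 'x) set" where
  "orbit_relation G M \<phi> = {(x, y). x \<in> space M \<and> y \<in> orbit G \<phi> x}"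

text \<open>A definition cannot quantify over types, so the type of the points of the probability spaces
  is a parameter. A theorem with a free type variable in this place covers all standard probability
  spaces.\<close>

definition fixed_price_one :: "'x itself \<Rightarrow> ('g, 'b) monoid_scheme \<Rightarrow> bool" where
  "fixed_price_one _ G \<longleftrightarrow>
     countable (carrier G) \<and>
     (\<forall>(M :: 'x measure) \<phi>.
        standard_prob_space M \<and> pmp_action G M \<phi> \<and> essentially_free G M \<phi> \<longrightarrow>
        cost M (orbit_relation G M \<phi>) = 1)"

section \<open>Amenability\<close>

text \<open>Von Neumann's definition: a finitely additive, left-invariant probability measure on all
  subsets of the group.\<close>

definition amenable :: "('g, 'b) monoid_scheme \<Rightarrow> bool" where
  "amenable G \<longleftrightarrow>
     (\<exists>m :: 'g set \<Rightarrow> real.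
        (\<forall>A. A \<subseteq> carrier G \<longrightarrow> 0 \<le> m A) \<and>
        m (carrier G) = 1 \<and>
        (\<forall>A B. A \<subseteq> carrier G \<longrightarrow> B \<subseteq> carrier G \<longrightarrow> A \<inter> B = {} \<longrightarrow> m (A \<union> B) = m A + m B) \<and>
        (\<forall>g\<in>carrier G. \<forall>A. A \<subseteq> carrier G \<longrightarrow> m (g <#\<^bsub>G\<^esub> A) = m A))"

end

theory Submission
  imports Defs
begin

text \<open>
  The first part follows from a Folner-type property of amenable groups: for every finite \<open>K\<close> there
  is a finite \<open>F\<close> such that \<open>F K\<close> has at most twice the size of \<open>F\<close>. Otherwise Hall's theorem
  (\<open>infinite_hall\<close>) would give a paradoxical decomposition. Taking \<open>S K\<close> in place of \<open>K\<close>, each element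
  of \<open>F S F\<inverse>\<close> has \<open>card K\<close> representations as a quotient of an element of \<open>F S K\<close> by an element of
  \<open>F K\<close>, hence \<open>F S F\<inverse>\<close> has at most \<open>4 (card F)\<^sup>2 / card K\<close> elements (\<open>amenable_sandwich_ratio\<close>).
  
  Fixed price one is proved directly from amenability, by two estimates for a free action.
  
  For the upper bound, iterating the same property gives Folner sets in the usual sense
  (\<open>amenable_folner\<close>). They are used to remove finite tiles from the space, one family of disjoint tiles
  after another. What matters is that a Folner set restricted to a set \<open>Y\<close> of positive measure is, for
  many points, a tile whose boundary relative to \<open>Y\<close> is still small (\<open>folner_tile\<close>). A star on each
  tile together with its boundary edges costs at most \<open>1 + e\<close> times the measure of the tiles, and an
  edge between two tiles is paid for when the first of them is removed. Exhausting the space in this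
  way yields a generating graphing of cost at most \<open>1 + e\<close> (\<open>cost_le_1\<close>).
  
  For the lower bound, orbits are infinite, so there are sets \<open>A\<close> of arbitrarily small measure that
  meet almost every orbit (\<open>small_complete_section\<close>). In any generating graphing, each point outside
  \<open>A\<close> can be charged an edge that brings it closer to \<open>A\<close>, and no edge is charged twice, so that the
  cost is at least the measure of the complement of \<open>A\<close> (\<open>graphing_cost_ge_complement_of_section\<close>).
\<close>

section \<open>Hall's theorem for infinite families of finite sets\<close>

text \<open>
  Rado's argument. By Zorn's lemma, delete as many pairs from the incidence relation as Hall's
  condition permits. If some \<open>i\<close> still had two candidates \<open>x\<close> and \<open>y\<close>, deleting either one would
  break the condition, which yields two critical sets; counting their union and intersection then
  contradicts Hall's condition for the union together with \<open>i\<close>. So one candidate is left for each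
  index, and Hall's condition for two indices says that these candidates differ.
\<close>

lemma infinite_hall:
  assumes fin: "\<And>i. i \<in> I \<Longrightarrow> finite (A i)"
    and hall: "\<And>J. J \<subseteq> I \<Longrightarrow> finite J \<Longrightarrow> card J \<le> card (\<Union>i\<in>J. A i)"
  obtains f where "inj_on f I" "\<And>i. i \<in> I \<Longrightarrow> f i \<in> A i"
proof -
  define R0 where "R0 = Sigma I A"
  define good where "good = (\<lambda>D. \<forall>J. J \<subseteq> I \<longrightarrow> finite J \<longrightarrow> card J \<le> card ((R0 - D) `` J))"
  have finR0: "finite (R0 \<inter> J \<times> UNIV)" if "J \<subseteq> I" "finite J" for J
  proof -
    have "R0 \<inter> J \<times> UNIV = Sigma J A" using that by (auto simp: R0_def)
    then show ?thesis using that fin by auto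
  qed
  have finIm: "finite ((R0 - D) `` J)" if "J \<subseteq> I" "finite J" for J D
    by (rule finite_subset[OF _ finite_imageI[OF finR0[OF that], of snd]]) force
  have empty: "good {}"
  proof -
    have "R0 `` J = (\<Union>i\<in>J. A i)" if "J \<subseteq> I" for J using that by (auto simp: R0_def)
    then show ?thesis using hall by (simp add: good_def)
  qed
  have "\<exists>D\<in>{D. good D}. \<forall>X\<in>{D. good D}. D \<subseteq> X \<longrightarrow> X = D"
  proof (rule subset_Zorn')
    fix C assume C: "subset.chain {D. good D} C"
    show "\<Union>C \<in> {D. good D}"
    proof (cases "C = {}")
      case True then show ?thesis using empty by simp
    next
      case False
      have "card J \<le> card ((R0 - \<Union>C) `` J)" if J: "J \<subseteq> I" "finite J" for J
      proof -
        \<comment> \<open>Only finitely many pairs over \<open>J\<close> are ever deleted, so one member of the chain has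
          already deleted all of them.\<close>
        have "finite (R0 \<inter> J \<times> UNIV \<inter> \<Union>C)" using finR0[OF J] by blast
        then obtain D where D: "D \<in> C" "R0 \<inter> J \<times> UNIV \<inter> \<Union>C \<subseteq> D"
          using finite_subset_Union_chain[OF _ _ False C] by (metis inf_le2)
        have "(R0 - \<Union>C) `` J = (R0 - D) `` J" using D by auto
        then show ?thesis using C D J unfolding good_def subset_chain_def by auto
      qed
      then show ?thesis by (simp add: good_def)
    qed
  qed
  then obtain D where D: "good D" and max: "\<And>X. good X \<Longrightarrow> D \<subseteq> X \<Longrightarrow> X = D" by auto
  define R where "R = R0 - D"
  have Rhall: "card J \<le> card (R `` J)" if "J \<subseteq> I" "finite J" for J
    using D that by (simp add: good_def R_def)
  have Rfin: "finite (R `` J)" if "J \<subseteq> I" "finite J" for J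
    using finIm[OF that] by (simp add: R_def)
  have critical: "\<exists>P. P \<subseteq> I \<and> finite P \<and> i \<notin> P \<and> card (R `` P \<union> (R `` {i} - {x})) \<le> card P"
    if ix: "(i, x) \<in> R" for i x
  proof -
    have "insert (i, x) D \<noteq> D" using ix by (auto simp: R_def)
    then have "\<not> good (insert (i, x) D)" using max by blast
    then obtain J where J: "J \<subseteq> I" "finite J" "card ((R0 - insert (i, x) D) `` J) < card J"
      by (auto simp: good_def not_le)
    have eq: "R0 - insert (i, x) D = R - {(i, x)}" by (auto simp: R_def)
    have iJ: "i \<in> J"
    proof (rule ccontr)
      assume "i \<notin> J"
      then have "(R - {(i, x)}) `` J = R `` J" by auto
      then show False using J Rhall eq by (metis not_le)
    qed
    have "(R - {(i, x)}) `` J = R `` (J - {i}) \<union> (R `` {i} - {x})" using iJ by auto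
    moreover have "card J = Suc (card (J - {i}))" using card.remove[OF J(2) iJ] .
    ultimately have "card (R `` (J - {i}) \<union> (R `` {i} - {x})) \<le> card (J - {i})"
      using J(3) unfolding eq by simp
    then show ?thesis using J(1,2) by (intro exI[of _ "J - {i}"]) (simp add: subset_iff)
  qed
  have single: "x = y" if xy: "(i, x) \<in> R" "(i, y) \<in> R" for i x y
  proof (rule ccontr)
    assume "x \<noteq> y"
    have iI: "i \<in> I" using xy by (auto simp: R_def R0_def)
    obtain P where P: "P \<subseteq> I" "finite P" "i \<notin> P" "card (R `` P \<union> (R `` {i} - {x})) \<le> card P"
      using critical[OF xy(1)] by blast
    obtain Q where Q: "Q \<subseteq> I" "finite Q" "i \<notin> Q" "card (R `` Q \<union> (R `` {i} - {y})) \<le> card Q"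
      using critical[OF xy(2)] by blast
    let ?U = "R `` P \<union> (R `` {i} - {x})" and ?V = "R `` Q \<union> (R `` {i} - {y})"
    have finU: "finite ?U" "finite ?V" using Rfin P Q iI by auto
    have "?U \<union> ?V = R `` insert i (P \<union> Q)" using \<open>x \<noteq> y\<close> by auto
    then have "Suc (card (P \<union> Q)) \<le> card (?U \<union> ?V)"
      using Rhall[of "insert i (P \<union> Q)"] P Q iI by auto
    moreover have "card (P \<inter> Q) \<le> card (?U \<inter> ?V)"
      using Rhall[of "P \<inter> Q"] card_mono[of "?U \<inter> ?V" "R `` (P \<inter> Q)"] finU P Q by fastforce
    moreover have "card (P \<union> Q) + card (P \<inter> Q) = card P + card Q"
      using card_Un_Int[OF P(2) Q(2)] by simp
    moreover have "card (?U \<union> ?V) + card (?U \<inter> ?V) = card ?U + card ?V"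
      using card_Un_Int[OF finU] by simp
    ultimately show False using P(4) Q(4) by linarith
  qed
  have ex: "\<exists>x. (i, x) \<in> R" if "i \<in> I" for i
  proof (rule ccontr)
    assume "\<not> ?thesis"
    then have "R `` {i} = {}" by blast
    then show False using Rhall[of "{i}"] that by simp
  qed
  define f where "f = (\<lambda>i. SOME x. (i, x) \<in> R)"
  have f: "(i, f i) \<in> R" if "i \<in> I" for i using someI_ex[OF ex[OF that]] by (simp add: f_def)
  show thesis
  proof
    show "inj_on f I"
    proof (rule inj_onI, rule ccontr)
      fix i j assume ij: "i \<in> I" "j \<in> I" "f i = f j" "i \<noteq> j"
      have "R `` {i, j} \<subseteq> {f i}"
        using f[OF ij(1)] f[OF ij(2)] single[of i] single[of j] ij(3) by auto
      then have "card (R `` {i, j}) \<le> 1" using card_mono[of "{f i}" "R `` {i, j}"] by simp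
      then show False using Rhall[of "{i, j}"] ij by simp
    qed
    show "f i \<in> A i" if "i \<in> I" for i using f[OF that] by (auto simp: R_def R0_def)
  qed
qed

section \<open>Small product sets in amenable groups\<close>

context group
begin

lemma card_l_translate:
  assumes "g \<in> carrier G" "A \<subseteq> carrier G"
  shows "card ((\<lambda>a. g \<otimes> a) ` A) = card A"
  using assms by (intro card_image) (auto simp: inj_on_def subset_iff)

lemma finite_set_mult: "finite A \<Longrightarrow> finite B \<Longrightarrow> finite (A <#> B)"
  by (simp add: set_mult_def)

text \<open>
  If left multiplication by \<open>K\<close> at least doubled every finite set, Hall's theorem would send two
  disjoint copies of the group injectively into the group, moving each point by an element of \<open>K\<close>
  only. Cutting according to the element of \<open>K\<close> that is used, this is a paradoxical decomposition,
  and the invariant mean of each of the two disjoint images would be 1.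
\<close>

lemma amenable_small_product_left:
  assumes am: "amenable G" and K: "finite K" "K \<subseteq> carrier G"
  shows "\<exists>F. finite F \<and> F \<subseteq> carrier G \<and> F \<noteq> {} \<and> card (K <#> F) < 2 * card F"
proof (rule ccontr)
  assume neg: "\<not> ?thesis"
  have big: "2 * card F \<le> card (K <#> F)" if "finite F" "F \<subseteq> carrier G" for F
  proof (cases "F = {}")
    case False
    then show ?thesis using neg that not_less by blast
  qed simp
  define A where "A = (\<lambda>(g, b::bool). K <#> {g})"
  obtain f where inj: "inj_on f (carrier G \<times> UNIV)"
    and f: "\<And>i. i \<in> carrier G \<times> UNIV \<Longrightarrow> f i \<in> A i"
  proof (rule infinite_hall[of "carrier G \<times> (UNIV :: bool set)" A])
    show "finite (A i)" for i using K by (auto simp: A_def finite_set_mult split: prod.split)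
    fix J :: "('a \<times> bool) set" assume J: "J \<subseteq> carrier G \<times> UNIV" "finite J"
    have "card J \<le> card (fst ` J \<times> (UNIV :: bool set))"
      using J by (intro card_mono) (auto intro: rev_image_eqI)
    also have "\<dots> = 2 * card (fst ` J)" by (simp add: card_cartesian_product)
    also have "\<dots> \<le> card (K <#> fst ` J)" using J by (intro big) auto
    also have "K <#> fst ` J = (\<Union>i\<in>J. A i)" unfolding A_def set_mult_def split_beta by blast
    finally show "card J \<le> card (\<Union>i\<in>J. A i)" .
  qed auto
  obtain m :: "'a set \<Rightarrow> real" where m: "(\<forall>A. A \<subseteq> carrier G \<longrightarrow> 0 \<le> m A) \<and> m (carrier G) = 1 \<and>
      (\<forall>A B. A \<subseteq> carrier G \<longrightarrow> B \<subseteq> carrier G \<longrightarrow> A \<inter> B = {} \<longrightarrow> m (A \<union> B) = m A + m B) \<and>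
      (\<forall>g\<in>carrier G. \<forall>A. A \<subseteq> carrier G \<longrightarrow> m (g <#\<^bsub>G\<^esub> A) = m A)"
    using am unfolding amenable_def by (elim exE)
  have m0: "0 \<le> m A" if "A \<subseteq> carrier G" for A using m that by simp
  have m1: "m (carrier G) = 1" using m by simp
  have madd: "m (A \<union> B) = m A + m B"
    if "A \<subseteq> carrier G" "B \<subseteq> carrier G" "A \<inter> B = {}" for A B using m that by simp
  have minv: "m (g <#\<^bsub>G\<^esub> A) = m A" if "g \<in> carrier G" "A \<subseteq> carrier G" for g A using m that by simp
  have mempty: "m {} = 0" using madd[of "{}" "{}"] by simp
  have mUN: "m (\<Union>k\<in>L. P k) = (\<Sum>k\<in>L. m (P k))"
    if "finite L" "\<And>k. k \<in> L \<Longrightarrow> P k \<subseteq> carrier G" "disjoint_family_on P L" for L :: "'a set" and P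
    using that
  proof (induction L)
    case (insert k L)
    have "P k \<inter> (\<Union>k\<in>L. P k) = {}"
      using insert.prems(2) insert.hyps by (auto simp: disjoint_family_on_def)
    then have "m (\<Union>k\<in>insert k L. P k) = m (P k) + m (\<Union>k\<in>L. P k)"
      using insert.prems(1) by (simp add: madd UN_least)
    then show ?case using insert by (simp add: disjoint_family_on_mono[OF subset_insertI])
  qed (simp add: mempty)
  \<comment> \<open>\<open>P k\<close> collects the points that the copy \<open>b\<close> moves by \<open>k\<close>; translating the pieces \<open>P k\<close>
    preserves their means, and both the pieces and their translates are disjoint.\<close>
  have half: "m ((\<lambda>g. f (g, b)) ` carrier G) = 1" for b
  proof -
    define P where "P = (\<lambda>k. {g \<in> carrier G. f (g, b) = k \<otimes> g})"
    have cov: "\<exists>k\<in>K. g \<in> P k" if "g \<in> carrier G" for g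
      using f[of "(g, b)"] that by (auto simp: A_def P_def set_mult_def)
    have disP: "disjoint_family_on P K"
      using K by (auto simp: disjoint_family_on_def P_def subset_iff)
    have fP: "k <#\<^bsub>G\<^esub> P k \<subseteq> (\<lambda>g. f (g, b)) ` carrier G" for k by (force simp: P_def l_coset_def)
    have disQ: "disjoint_family_on (\<lambda>k. k <#\<^bsub>G\<^esub> P k) K"
      unfolding disjoint_family_on_def
    proof (intro ballI impI)
      fix k l assume kl: "k \<in> K" "l \<in> K" "k \<noteq> l"
      show "(k <#\<^bsub>G\<^esub> P k) \<inter> (l <#\<^bsub>G\<^esub> P l) = {}"
      proof (rule ccontr)
        assume "(k <#\<^bsub>G\<^esub> P k) \<inter> (l <#\<^bsub>G\<^esub> P l) \<noteq> {}"
        then obtain g h where gh: "g \<in> P k" "h \<in> P l" "k \<otimes> g = l \<otimes> h" by (auto simp: l_coset_def)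
        then have "f (g, b) = f (h, b)" by (auto simp: P_def)
        then have "g = h" using gh inj_onD[OF inj, of "(g, b)" "(h, b)"] by (auto simp: P_def)
        then show False using gh kl K by (auto simp: P_def subset_iff)
      qed
    qed
    have "(\<lambda>g. f (g, b)) ` carrier G = (\<Union>k\<in>K. k <#\<^bsub>G\<^esub> P k)"
    proof
      show "(\<lambda>g. f (g, b)) ` carrier G \<subseteq> (\<Union>k\<in>K. k <#\<^bsub>G\<^esub> P k)"
        using cov by (force simp: P_def l_coset_def)
    qed (use fP in blast)
    then have "m ((\<lambda>g. f (g, b)) ` carrier G) = (\<Sum>k\<in>K. m (k <#\<^bsub>G\<^esub> P k))"
      using mUN[OF K(1) _ disQ] K(2) by (force simp: P_def l_coset_def)
    also have "\<dots> = (\<Sum>k\<in>K. m (P k))"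
      using K by (intro sum.cong refl minv) (auto simp: P_def)
    also have "\<dots> = m (\<Union>k\<in>K. P k)"
      using mUN[OF K(1) _ disP] by (auto simp: P_def)
    also have "(\<Union>k\<in>K. P k) = carrier G" using cov by (auto simp: P_def)
    finally show ?thesis using m1 by simp
  qed
  let ?B = "\<lambda>b. (\<lambda>g. f (g, b)) ` carrier G"
  have sub: "?B b \<subseteq> carrier G" for b
  proof clarify
    fix g assume g: "g \<in> carrier G"
    then have "f (g, b) \<in> K <#> {g}" using f[of "(g, b)"] by (simp add: A_def)
    then show "f (g, b) \<in> carrier G" using g K by (auto simp: set_mult_def)
  qed
  have "?B True \<inter> ?B False = {}"
  proof (rule ccontr)
    assume "?B True \<inter> ?B False \<noteq> {}"
    then obtain g h where "g \<in> carrier G" "h \<in> carrier G" "f (g, True) = f (h, False)" by blast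
    then show False using inj_onD[OF inj, of "(g, True)" "(h, False)"] by simp
  qed
  then have "m (?B True \<union> ?B False) = 2" using madd[OF sub sub] half by simp
  moreover have "m (carrier G) = m (?B True \<union> ?B False) + m (carrier G - (?B True \<union> ?B False))"
  proof -
    have "carrier G = (?B True \<union> ?B False) \<union> (carrier G - (?B True \<union> ?B False))"
      using sub by blast
    then show ?thesis using madd[of "?B True \<union> ?B False" "carrier G - (?B True \<union> ?B False)"] sub
      by (metis Diff_disjoint Diff_subset Un_least)
  qed
  ultimately show False using m0[of "carrier G - (?B True \<union> ?B False)"] m1 by simp
qed

lemma set_inv_eq_image: "set_inv A = (\<lambda>a. inv a) ` A"
  by (auto simp: SET_INV_def)

lemma card_set_inv:
  assumes "A \<subseteq> carrier G" shows "card (set_inv A) = card A"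
  unfolding set_inv_eq_image using inj_on_subset[OF inv_inj assms] by (rule card_image)

text \<open>
  Inversion turns the left-handed statement into the right-handed one. A further left translation,
  which changes no cardinality, moves the unit into \<open>F\<close>.
\<close>

lemma amenable_small_product_right:
  assumes am: "amenable G" and K: "finite K" "K \<subseteq> carrier G"
  obtains F where "finite F" "F \<subseteq> carrier G" "\<one> \<in> F" "card (F <#> K) \<le> 2 * card F"
proof -
  have iK: "finite (set_inv K)" "set_inv K \<subseteq> carrier G" using K by (auto simp: set_inv_eq_image)
  obtain E where E: "finite E" "E \<subseteq> carrier G" "E \<noteq> {}" "card (set_inv K <#> E) < 2 * card E"
    using amenable_small_product_left[OF am iK] by blast
  obtain e where e: "e \<in> E" using E by blast
  define F where "F = (\<lambda>x. e \<otimes> x) ` (set_inv E)"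
  have ec: "e \<in> carrier G" using e E by blast
  have iE: "set_inv E \<subseteq> carrier G" using E by (auto simp: set_inv_eq_image)
  have "F <#> K = (\<lambda>x. e \<otimes> x) ` (set_inv (set_inv K <#> E))"
  proof -
    have "(e \<otimes> inv x) \<otimes> k = e \<otimes> inv (inv k \<otimes> x)" if "x \<in> E" "k \<in> K" for x k
      using that E K ec by (simp add: inv_mult_group m_assoc subset_iff)
    then show ?thesis unfolding F_def set_inv_eq_image set_mult_def by (auto simp: image_iff)
  qed
  moreover have KE: "set_inv K <#> E \<subseteq> carrier G" using iK E set_mult_closed by blast
  moreover have "set_inv (set_inv K <#> E) \<subseteq> carrier G"
    using KE unfolding set_inv_eq_image[of "set_inv K <#> E"] by auto
  ultimately have "card (F <#> K) = card (set_inv K <#> E)"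
    using card_l_translate[OF ec] card_set_inv[OF KE] by metis
  moreover have "card F = card E"
    using card_l_translate[OF ec iE] card_set_inv[OF E(2)] by (simp add: F_def)
  moreover have "\<one> \<in> F" using e ec by (force simp: F_def set_inv_eq_image)
  moreover have "F \<subseteq> carrier G" using ec iE by (auto simp: F_def)
  moreover have "finite F" using E by (simp add: F_def set_inv_eq_image)
  ultimately show thesis using that E(4) by simp
qed

text \<open>
  An element \<open>f s f'\<inverse>\<close> of the set \<open>F S F\<inverse>\<close> is also \<open>(f s k) (f' k)\<inverse>\<close> for every \<open>k \<in> K\<close>, hence
  it has at least \<open>card K\<close> representations as a quotient of an element of \<open>F S K\<close> by one of \<open>F K\<close>.
\<close>

lemma card_sandwich_le:
  assumes F: "finite F" "F \<subseteq> carrier G" and S: "finite S" "S \<subseteq> carrier G"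
    and K: "finite K" "K \<subseteq> carrier G"
  shows "card (F <#> S <#> set_inv F) * card K \<le> card (F <#> (S <#> K)) * card (F <#> K)"
proof -
  let ?X = "F <#> S <#> set_inv F"
  have "\<forall>x\<in>?X. \<exists>p. fst p \<in> F <#> S \<and> snd p \<in> F \<and> x = fst p \<otimes> inv (snd p)"
    by (auto simp: set_mult_def set_inv_eq_image)
  then obtain p where p: "\<And>x. x \<in> ?X \<Longrightarrow> fst (p x) \<in> F <#> S \<and> snd (p x) \<in> F \<and> x = fst (p x) \<otimes> inv (snd (p x))"
    by metis
  have FS: "F <#> S \<subseteq> carrier G" using F S set_mult_closed by blast
  have FSK: "F <#> (S <#> K) = F <#> S <#> K" using F S K by (simp add: set_mult_assoc)
  let ?h = "\<lambda>(x, k). (fst (p x) \<otimes> k, snd (p x) \<otimes> k)"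
  have quot: "(a \<otimes> k) \<otimes> inv (b \<otimes> k) = a \<otimes> inv b"
    if "a \<in> carrier G" "b \<in> carrier G" "k \<in> carrier G" for a b k
  proof -
    have "k \<otimes> (inv k \<otimes> inv b) = inv b" using that by (metis inv_closed l_one m_assoc r_inv)
    then show ?thesis using that by (simp add: inv_mult_group m_assoc)
  qed
  have "inj_on ?h (?X \<times> K)"
  proof (rule inj_onI, clarify)
    fix x k y l
    assume x: "x \<in> ?X" "k \<in> K" and y: "y \<in> ?X" "l \<in> K"
      and eq: "fst (p x) \<otimes> k = fst (p y) \<otimes> l" "snd (p x) \<otimes> k = snd (p y) \<otimes> l"
    have c: "fst (p x) \<in> carrier G" "snd (p x) \<in> carrier G" "fst (p y) \<in> carrier G"
      "snd (p y) \<in> carrier G" "k \<in> carrier G" "l \<in> carrier G"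
      using p x y FS F K by blast+
    have "x = y" using quot[of "fst (p x)" "snd (p x)" k] quot[of "fst (p y)" "snd (p y)" l]
      p[OF x(1)] p[OF y(1)] eq c by metis
    moreover from this have "k = l" using eq c by simp
    ultimately show "x = y \<and> k = l" by blast
  qed
  moreover have "?h ` (?X \<times> K) \<subseteq> (F <#> (S <#> K)) \<times> (F <#> K)"
  proof clarify
    fix x k assume xk: "x \<in> ?X" "k \<in> K"
    then show "fst (p x) \<otimes> k \<in> F <#> (S <#> K) \<and> snd (p x) \<otimes> k \<in> F <#> K"
      using p[OF xk(1)] unfolding FSK by (auto simp: set_mult_def[of _ _ K])
  qed
  ultimately have "card (?X \<times> K) \<le> card ((F <#> (S <#> K)) \<times> (F <#> K))"
    using F S K by (intro card_inj_on_le) (auto simp: finite_set_mult)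
  then show ?thesis by (simp add: card_cartesian_product)
qed

text \<open>
  Choose \<open>F\<close> such that \<open>F S K\<close> has at most twice the size of \<open>F\<close>; then \<open>F K\<close> is no larger, because
  \<open>S\<close> contains the unit, and the preceding count bounds the ratio by \<open>4 / card K\<close>. In an infinite
  group \<open>K\<close> can be as large as desired.
\<close>

lemma amenable_sandwich_ratio:
  assumes inf: "infinite (carrier G)" and am: "amenable G"
    and S: "finite S" "S \<subseteq> carrier G" "\<one> \<in> S"
  obtains F :: "nat \<Rightarrow> 'a set"
  where "\<And>n. F n \<subseteq> carrier G" "\<And>n. finite (F n)" "\<And>n. \<one> \<in> F n"
    "(\<lambda>n. real (card (F n <#> S <#> set_inv (F n))) / (real (card (F n)))\<^sup>2) \<longlonglongrightarrow> 0"
proof -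
  have "\<exists>F. F \<subseteq> carrier G \<and> finite F \<and> \<one> \<in> F \<and>
      real (card (F <#> S <#> set_inv F)) / (real (card F))\<^sup>2 \<le> 4 / real (Suc n)" for n
  proof -
    obtain K where K: "K \<subseteq> carrier G" "finite K" "card K = Suc n"
      using infinite_arbitrarily_large[OF inf] by metis
    have SK: "finite (S <#> K)" "S <#> K \<subseteq> carrier G"
      using S K by (simp_all add: finite_set_mult set_mult_closed)
    obtain F where F: "finite F" "F \<subseteq> carrier G" "\<one> \<in> F" "card (F <#> (S <#> K)) \<le> 2 * card F"
      using amenable_small_product_right[OF am SK] .
    have "K \<subseteq> S <#> K" using S K by (force simp: set_mult_def)
    then have "F <#> K \<subseteq> F <#> (S <#> K)" by (rule mono_set_mult[OF order_refl])
    then have "card (F <#> K) \<le> 2 * card F"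
      using F SK card_mono[of "F <#> (S <#> K)" "F <#> K"] by (simp add: finite_set_mult)
    then have "card (F <#> S <#> set_inv F) * card K \<le> (2 * card F) * (2 * card F)"
      using card_sandwich_le[OF F(1,2) S(1,2) K(2,1)] F(4) by (meson le_trans mult_le_mono)
    then have "real (card (F <#> S <#> set_inv F) * card K) \<le> real ((2 * card F) * (2 * card F))"
      by (rule of_nat_mono)
    then have "real (card (F <#> S <#> set_inv F)) * Suc n \<le> 4 * (real (card F))\<^sup>2"
      using K(3) by (simp add: power2_eq_square algebra_simps)
    moreover have "card F > 0" using F by (auto simp: card_gt_0_iff)
    ultimately show ?thesis using F
      by (intro exI[of _ F]) (simp add: divide_simps mult.commute)
  qed
  then obtain F where F: "\<And>n. F n \<subseteq> carrier G" "\<And>n. finite (F n)" "\<And>n. \<one> \<in> F n"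
    "\<And>n. real (card (F n <#> S <#> set_inv (F n))) / (real (card (F n)))\<^sup>2 \<le> 4 / real (Suc n)"
    by metis
  have "(\<lambda>n. 4 / real (Suc n)) \<longlonglongrightarrow> 0"
    by (rule LIMSEQ_Suc) (rule lim_const_over_n)
  then have "(\<lambda>n. real (card (F n <#> S <#> set_inv (F n))) / (real (card (F n)))\<^sup>2) \<longlonglongrightarrow> 0"
    by (rule tendsto_sandwich[rotated 3]) (use F(4) in auto)
  with F that show thesis by blast
qed

text \<open>
  If multiplication by \<open>S\<close> enlarged every finite set by the factor \<open>1 + d\<close>, a high power of \<open>S\<close> would
  enlarge every finite set more than twofold.
\<close>

lemma amenable_folner:
  fixes d :: real
  assumes am: "amenable G" and S: "finite S" "S \<subseteq> carrier G" and d: "0 < d"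
  shows "\<exists>F. finite F \<and> F \<subseteq> carrier G \<and> F \<noteq> {} \<and> real (card (S <#> F)) \<le> (1 + d) * real (card F)"
proof (rule ccontr)
  assume neg: "\<not> ?thesis"
  have big: "(1 + d) * real (card F) \<le> real (card (S <#> F))" if "finite F" "F \<subseteq> carrier G" for F
  proof (cases "F = {}")
    case False
    then show ?thesis using neg that linear by blast
  qed simp
  define P where "P = (\<lambda>n. ((\<lambda>A. S <#> A) ^^ n) {\<one>})"
  have P: "finite (P n)" "P n \<subseteq> carrier G" for n
    using S by (induction n) (auto simp: P_def finite_set_mult set_mult_closed)
  have PS: "P (Suc n) <#> F = S <#> (P n <#> F)" if "F \<subseteq> carrier G" for F n
    using that P[of n] S by (simp add: P_def set_mult_assoc)
  have pow: "(1 + d) ^ n * card F \<le> card (P n <#> F)" if F: "finite F" "F \<subseteq> carrier G" for F n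
  proof (induction n)
    case 0
    have "P 0 <#> F = F" using F by (auto simp: P_def set_mult_def subset_iff)
    then show ?case by simp
  next
    case (Suc n)
    have "(1 + d) ^ Suc n * card F \<le> (1 + d) * card (P n <#> F)"
      using Suc d by (simp add: mult.assoc)
    also have "\<dots> \<le> card (P (Suc n) <#> F)"
      unfolding PS[OF F(2)] using F P[of n] by (intro big) (auto simp: finite_set_mult set_mult_closed)
    finally show ?case .
  qed
  obtain n where n: "2 < (1 + d) ^ n" using real_arch_pow[of "1 + d" 2] d by auto
  obtain F where F: "finite F" "F \<subseteq> carrier G" "F \<noteq> {}" "card (P n <#> F) < 2 * card F"
    using amenable_small_product_left[OF am P[of n]] by blast
  have "2 * real (card F) \<le> (1 + d) ^ n * card F" using n by (intro mult_right_mono) auto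
  then show False using pow[OF F(1,2), of n] F(4) by linarith
qed

lemma countable_generate:
  assumes "countable S" "S \<subseteq> carrier G" "set_inv S = S"
  shows "countable (generate G S)"
proof -
  let ?f = "\<lambda>l. foldr (\<otimes>) l \<one>"
  have clo: "?f l \<in> carrier G" if "set l \<subseteq> S" for l using that assms(2) by (induction l) auto
  have app: "?f (k @ l) = ?f k \<otimes> ?f l" if "set k \<subseteq> S" "set l \<subseteq> S" for k l
    using that assms(2) clo by (induction k) (auto simp: m_assoc subset_iff)
  have "generate G S \<subseteq> ?f ` lists S"
  proof
    fix g assume "g \<in> generate G S"
    then show "g \<in> ?f ` lists S"
    proof induction
      case one then show ?case by (intro image_eqI[of _ _ "[]"]) auto
    next
      case (incl h) then show ?case using assms(2) by (intro image_eqI[of _ _ "[h]"]) auto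
    next
      case (inv h)
      then have "inv h \<in> S" using assms(3) by (auto simp: set_inv_eq_image)
      then show ?case using assms(2) by (intro image_eqI[of _ _ "[inv h]"]) auto
    next
      case (eng a b)
      then obtain k l where "a = ?f k" "b = ?f l" "set k \<subseteq> S" "set l \<subseteq> S" by auto
      then show ?case using app by (intro image_eqI[of _ _ "k @ l"]) auto
    qed
  qed
  then show ?thesis using assms(1) by (meson countable_image countable_lists countable_subset)
qed

end

section \<open>Exhaustion and separation in measure spaces\<close>

text \<open>
  The measure-theoretic substitute for a transfinite exhaustion, where \<open>R Y Z\<close> means that \<open>Y\<close> can be
  reduced to \<open>Z\<close>. At each step pass to a \<open>Z\<close> whose measure is almost the infimum over all possible
  reductions; the limit cannot be reduced to a set of smaller measure, so it is null. Assumption \<open>lim\<close>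
  gives transitivity too, by an eventually constant sequence.
\<close>

lemma (in prob_space) exhaustion:
  fixes R :: "'a set \<Rightarrow> 'a set \<Rightarrow> bool"
  assumes refl: "\<And>Y. Y \<in> sets M \<Longrightarrow> R Y Y"
    and sub: "\<And>Y Z. R Y Z \<Longrightarrow> Z \<in> sets M \<and> Z \<subseteq> Y"
    and lim: "\<And>Y :: nat \<Rightarrow> 'a set. (\<And>n. R (Y n) (Y (Suc n))) \<Longrightarrow> R (Y 0) (\<Inter>n. Y n)"
    and progress: "\<And>Y. R (space M) Y \<Longrightarrow> 0 < measure M Y \<Longrightarrow> \<exists>Z. R Y Z \<and> measure M Z < measure M Y"
  shows "\<exists>Y. R (space M) Y \<and> measure M Y = 0"
proof -
  have trans: "R X Z" if R: "R X Y" "R Y Z" for X Y Z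
  proof -
    define W where "W = (\<lambda>n::nat. if n = 0 then X else if n = 1 then Y else Z)"
    have "R (W n) (W (Suc n))" for n
      using R refl sub by (auto simp: W_def)
    then have "R (W 0) (\<Inter>n. W n)" by (rule lim)
    moreover have "(\<Inter>n. W n) = Z"
    proof
      show "(\<Inter>n. W n) \<subseteq> Z" using INT_lower[of 2 UNIV W] by (simp add: W_def)
      show "Z \<subseteq> (\<Inter>n. W n)" using sub[OF R(1)] sub[OF R(2)] by (auto simp: W_def)
    qed
    ultimately show ?thesis by (simp add: W_def)
  qed
  define Q where "Q = (\<lambda>n Y Z. R Y Z \<and> (\<forall>W. R Y W \<longrightarrow> measure M Z \<le> measure M W + 1 / real (Suc n)))"
  have "\<exists>Y. \<forall>n. R (space M) (Y n) \<and> Q n (Y n) (Y (Suc n))"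
  proof (rule dependent_nat_choice)
    show "\<exists>Y. R (space M) Y" using refl by blast
    fix Y n assume Y: "R (space M) Y"
    let ?V = "measure M ` {W. R Y W}"
    have ne: "?V \<noteq> {}" using refl sub[OF Y] by blast
    have bdd: "bdd_below ?V" by (rule bdd_belowI[of _ 0]) auto
    have "Inf ?V < Inf ?V + 1 / real (Suc n)" by simp
    then obtain v where v: "v \<in> ?V" "v < Inf ?V + 1 / real (Suc n)"
      using cInf_lessD[OF ne] by blast
    then obtain Z where Z: "R Y Z" "v = measure M Z" by auto
    have "measure M Z \<le> measure M W + 1 / real (Suc n)" if "R Y W" for W
      using cInf_lower[OF _ bdd, of "measure M W"] that v Z by fastforce
    then have "Q n Y Z" using Z by (simp add: Q_def)
    then show "\<exists>Z. R (space M) Z \<and> Q n Y Z" using trans[OF Y] by (auto simp: Q_def)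
  qed
  then obtain Y where Y: "\<And>n. R (space M) (Y n)" "\<And>n. Q n (Y n) (Y (Suc n))" by blast
  have step: "R (Y n) (Y (Suc n))" for n using Y by (simp add: Q_def)
  have mono: "Y n \<subseteq> Y m" if "m \<le> n" for m n
    using lift_Suc_antimono_le[of Y m n] sub[OF step] that by blast
  define Z where "Z = (\<Inter>n. Y n)"
  have toZ: "R (Y n) Z" for n
  proof -
    have "R (Y (n + 0)) (\<Inter>k. Y (n + k))" by (rule lim) (simp add: step)
    moreover have "(\<Inter>k. Y (n + k)) = Z"
    proof
      show "(\<Inter>k. Y (n + k)) \<subseteq> Z" unfolding Z_def using mono[of _ "n + _"] le_add2 by blast
    qed (auto simp: Z_def)
    ultimately show ?thesis by simp
  qed
  have "R (space M) Z" using trans[OF Y(1) toZ] .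
  moreover have "measure M Z = 0"
  proof (rule ccontr)
    assume "measure M Z \<noteq> 0"
    then have "0 < measure M Z" by (simp add: less_le)
    then obtain W where W: "R Z W" "measure M W < measure M Z" using progress[OF \<open>R (space M) Z\<close>] by blast
    obtain n where n: "1 / real (Suc n) < measure M Z - measure M W"
      using W(2) reals_Archimedean[of "measure M Z - measure M W"] by (auto simp: inverse_eq_divide)
    have "measure M Z \<le> measure M (Y (Suc n))"
      using sub[OF Y(1)] by (intro finite_measure_mono) (auto simp: Z_def)
    moreover have "measure M (Y (Suc n)) \<le> measure M W + 1 / real (Suc n)"
      using Y(2)[of n] trans[OF toZ W(1)] by (simp add: Q_def)
    ultimately show False using n by linarith
  qed
  ultimately show ?thesis by blast
qed

lemma emeasure_decrement_sum:
  fixes Y :: "nat \<Rightarrow> 'a set"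
  assumes Y: "\<And>n. Y n \<in> sets M" "\<And>n. Y (Suc n) \<subseteq> Y n"
  shows "(\<Sum>n. emeasure M (Y n - Y (Suc n))) = emeasure M (Y 0 - (\<Inter>n. Y n))"
proof -
  have mono: "Y n \<subseteq> Y m" if "m \<le> n" for m n
    using lift_Suc_antimono_le[of Y m n] Y(2) that by blast
  have "disjoint_family (\<lambda>n. Y n - Y (Suc n))"
    unfolding disjoint_family_on_def
  proof (intro ballI impI)
    fix m n :: nat assume "m \<noteq> n"
    then consider "Suc m \<le> n" | "Suc n \<le> m" by linarith
    then show "(Y m - Y (Suc m)) \<inter> (Y n - Y (Suc n)) = {}" by cases (use mono in blast)+
  qed
  then have "(\<Sum>n. emeasure M (Y n - Y (Suc n))) = emeasure M (\<Union>n. Y n - Y (Suc n))"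
    using Y(1) by (intro suminf_emeasure) auto
  also have "(\<Union>n. Y n - Y (Suc n)) = Y 0 - (\<Inter>n. Y n)"
  proof
    show "(\<Union>n. Y n - Y (Suc n)) \<subseteq> Y 0 - (\<Inter>n. Y n)" using mono[OF le0] by blast
    show "Y 0 - (\<Inter>n. Y n) \<subseteq> (\<Union>n. Y n - Y (Suc n))"
    proof
      fix x assume x: "x \<in> Y 0 - (\<Inter>n. Y n)"
      define k where "k = (LEAST k. x \<notin> Y k)"
      obtain l where "x \<notin> Y l" using x by blast
      then have k: "x \<notin> Y k" unfolding k_def by (rule LeastI)
      then obtain m where m: "k = Suc m" using x by (cases k) auto
      have "x \<in> Y m" using not_less_Least[of m "\<lambda>k. x \<notin> Y k"] m by (auto simp: k_def)
      then show "x \<in> (\<Union>n. Y n - Y (Suc n))" using k m by auto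
    qed
  qed
  finally show ?thesis .
qed

text \<open>
  A countable base of the Hausdorff topology does it. Such a family turns the statement that an element
  of the group moves almost every point into one about disjoint sets of positive measure.
\<close>

lemma standard_borel_separating:
  assumes "standard_borel_space M"
  obtains D :: "nat \<Rightarrow> 'x set"
  where "\<And>n. D n \<in> sets M"
    "\<And>x y. x \<in> space M \<Longrightarrow> y \<in> space M \<Longrightarrow> x \<noteq> y \<Longrightarrow> \<exists>n. x \<in> D n \<and> y \<notin> D n"
proof -
  obtain T where T: "topspace T = space M" "completely_metrizable_space T" "second_countable T"
    "sets M = sigma_sets (space M) {U. openin T U}"
    using assms by (auto simp: standard_borel_space_def)
  obtain \<B> where B: "countable \<B>" "\<And>V. V \<in> \<B> \<Longrightarrow> openin T V"
    "\<And>U x. openin T U \<Longrightarrow> x \<in> U \<Longrightarrow> \<exists>V\<in>\<B>. x \<in> V \<and> V \<subseteq> U"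
    using T(3) unfolding second_countable_def by metis
  have haus: "Hausdorff_space T"
    using T(2) completely_metrizable_imp_metrizable_space metrizable_imp_Hausdorff_space by blast
  define D where "D = from_nat_into (insert {} \<B>)"
  have D: "range D = insert {} \<B>"
    unfolding D_def using B(1) by (intro range_from_nat_into) auto
  show thesis
  proof
    fix n show "D n \<in> sets M"
    proof -
      have "D n \<in> insert {} \<B>" using D by blast
      then show ?thesis using B(2) T(4) by auto
    qed
  next
    fix x y assume "x \<in> space M" "y \<in> space M" "x \<noteq> y"
    then obtain U V where "openin T U" "x \<in> U" "y \<in> V" "U \<inter> V = {}"
      using haus T(1) unfolding Hausdorff_space_def disjnt_def by metis
    then obtain W where "W \<in> \<B>" "x \<in> W" "y \<notin> W" using B(3) by blast
    then show "\<exists>n. x \<in> D n \<and> y \<notin> D n" using D by (metis insertI2 rangeE)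
  qed
qed

section \<open>Graph distance and a lower bound for the cost\<close>

lemma measure_preserving_iso_image:
  assumes f: "measure_preserving_iso M A B f" and C: "C \<in> sets M" "C \<subseteq> A"
  shows "f ` C \<in> sets M" "emeasure M (f ` C) = emeasure M C"
proof -
  have A: "A \<in> sets M" and B: "B \<in> sets M" and bij: "bij_betw f A B"
    and m: "f \<in> measurable (restrict_space M A) (restrict_space M B)"
    and mi: "inv_into A f \<in> measurable (restrict_space M B) (restrict_space M A)"
    and d: "distr (restrict_space M A) (restrict_space M B) f = restrict_space M B"
    using f by (auto simp: measure_preserving_iso_def)
  have spA: "space (restrict_space M A) = A" "space (restrict_space M B) = B" using A B by simp_all
  have Cr: "C \<in> sets (restrict_space M A)" using A C by (simp add: sets_restrict_space_iff)
  have im: "f ` C = inv_into A f -` C \<inter> B"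
  proof
    show "f ` C \<subseteq> inv_into A f -` C \<inter> B"
      using bij C by (auto simp: bij_betw_def inv_into_f_f subset_iff)
    show "inv_into A f -` C \<inter> B \<subseteq> f ` C"
    proof
      fix y assume "y \<in> inv_into A f -` C \<inter> B"
      then show "y \<in> f ` C" using bij by (intro image_eqI[of _ _ "inv_into A f y"])
          (auto simp: bij_betw_def f_inv_into_f)
    qed
  qed
  have fCr: "f ` C \<in> sets (restrict_space M B)"
    using measurable_sets[OF mi Cr] by (simp add: im spA)
  then show fC: "f ` C \<in> sets M" using B by (simp add: sets_restrict_space_iff)
  have sub: "f ` C \<subseteq> B" using im by blast
  have "emeasure M (f ` C) = emeasure (distr (restrict_space M A) (restrict_space M B) f) (f ` C)"
    unfolding d using B sub by (simp add: emeasure_restrict_space)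
  also have "\<dots> = emeasure (restrict_space M A) (f -` (f ` C) \<inter> A)"
    using emeasure_distr[OF m fCr] by (simp add: spA)
  also have "f -` (f ` C) \<inter> A = C" using bij C by (auto simp: bij_betw_def dest: inj_onD)
  finally show "emeasure M (f ` C) = emeasure M C"
    using A C by (simp add: emeasure_restrict_space)
qed

lemma measure_preserving_iso_vimage:
  assumes f: "measure_preserving_iso M A B f" and D: "D \<in> sets M"
  shows "{x \<in> A. f x \<in> D} \<in> sets M"
proof -
  have A: "A \<in> sets M" and B: "B \<in> sets M" and bij: "bij_betw f A B"
    and m: "f \<in> measurable (restrict_space M A) (restrict_space M B)"
    using f by (auto simp: measure_preserving_iso_def)
  have "D \<inter> B \<in> sets (restrict_space M B)" using B D by (simp add: sets_restrict_space_iff)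
  then have "f -` (D \<inter> B) \<inter> A \<in> sets (restrict_space M A)" using measurable_sets[OF m] A by force
  then have "f -` (D \<inter> B) \<inter> A \<in> sets M" using A by (simp add: sets_restrict_space_iff)
  moreover have "f -` (D \<inter> B) \<inter> A = {x \<in> A. f x \<in> D}" using bij by (auto simp: bij_betw_def)
  ultimately show ?thesis by simp
qed

lemma infsum_ennreal_eq_suminf:
  fixes f :: "nat \<Rightarrow> ennreal"
  shows "infsum f I = (\<Sum>i. if i \<in> I then f i else 0)"
proof -
  let ?g = "\<lambda>i. if i \<in> I then f i else 0"
  have "infsum f I = infsum ?g UNIV" by (intro infsum_cong_neutral) auto
  moreover have "?g sums infsum ?g UNIV"
    by (intro has_sum_imp_sums has_sum_infsum nonneg_summable_on_complete) simp
  ultimately show ?thesis by (simp add: sums_iff)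
qed

lemma suminf_ennreal_swap:
  fixes f :: "nat \<Rightarrow> nat \<Rightarrow> ennreal"
  shows "(\<Sum>m. \<Sum>n. f m n) = (\<Sum>n. \<Sum>m. f m n)"
  using nn_integral_suminf[of "\<lambda>n m. f m n" "count_space UNIV"]
  by (simp add: nn_integral_count_space_nat)

text \<open>
  Levitt's lower bound. Let \<open>D n\<close> be the set of points at graph distance at most \<open>n\<close> from \<open>A\<close>. Almost
  every point outside \<open>A\<close> lies in exactly one layer \<open>L n = D (Suc n) - D n\<close> and has an edge leading
  to \<open>D n\<close>. An edge is charged by at most one of its end points, the farther one, so the total measure
  of the edges is at least the measure of the complement of \<open>A\<close>.
\<close>

lemma graphing_cost_ge_complement_of_section:
  assumes iso: "\<And>i. i \<in> index \<Phi> \<Longrightarrow> measure_preserving_iso M (source \<Phi> i) (target \<Phi> i) (pmap \<Phi> i)"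
    and A: "A \<in> sets M"
    and reach: "AE x in M. graphing_component \<Phi> x \<inter> A \<noteq> {}"
  shows "emeasure M (space M - A) \<le> graphing_cost M \<Phi>"
proof -
  define I where "I = index \<Phi>"
  define src where "src = source \<Phi>"
  define f where "f = pmap \<Phi>"
  have iso: "measure_preserving_iso M (src i) (target \<Phi> i) (f i)" if "i \<in> I" for i
    using iso that by (simp add: I_def src_def f_def)
  have srcM: "src i \<in> sets M" if "i \<in> I" for i using iso[OF that] by (simp add: measure_preserving_iso_def)
  define N where "N = (\<lambda>D. D \<union> (\<Union>i\<in>I. f i ` (D \<inter> src i) \<union> {x \<in> src i. f i x \<in> D}))"
  define D where "D = (\<lambda>n. (N ^^ n) A)"
  have D0: "D 0 = A" and DS: "D (Suc n) = N (D n)" for n by (simp_all add: D_def)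
  have NM: "N X \<in> sets M" if X: "X \<in> sets M" for X
  proof -
    have "f i ` (X \<inter> src i) \<union> {x \<in> src i. f i x \<in> X} \<in> sets M" if "i \<in> I" for i
      using measure_preserving_iso_image(1)[OF iso[OF that], of "X \<inter> src i"]
        measure_preserving_iso_vimage[OF iso[OF that] X] srcM[OF that] X by auto
    then show ?thesis unfolding N_def using X by (intro sets.Un sets.countable_UN') auto
  qed
  have DM: "D n \<in> sets M" for n by (induction n) (simp_all add: D0 DS A NM)
  have Dmono: "D m \<subseteq> D n" if "m \<le> n" for m n
    using that by (rule lift_Suc_mono_le[rotated]) (auto simp: DS N_def)
  define L where "L = (\<lambda>n. D (Suc n) - D n)"
  \<comment> \<open>\<open>E i n\<close> is the part of the domain of the \<open>i\<close>-th map where it joins \<open>L n\<close> to \<open>D n\<close>, in either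
    direction. For fixed \<open>i\<close> these parts are disjoint, since the farther end point determines \<open>n\<close>.\<close>
  define E where "E = (\<lambda>i n. {x \<in> D n \<inter> src i. f i x \<in> L n} \<union> {x \<in> L n \<inter> src i. f i x \<in> D n})"
  have LM: "L n \<in> sets M" for n using DM by (simp add: L_def)
  have EM1: "{x \<in> X \<inter> src i. f i x \<in> Z} \<in> sets M" if "i \<in> I" "X \<in> sets M" "Z \<in> sets M" for i X Z
  proof -
    have "{x \<in> X \<inter> src i. f i x \<in> Z} = X \<inter> {x \<in> src i. f i x \<in> Z}" by auto
    then show ?thesis using measure_preserving_iso_vimage[OF iso[OF that(1)] that(3)] that(2) by auto
  qed
  have EM: "E i n \<in> sets M" if "i \<in> I" for i n
    unfolding E_def using EM1[OF that] DM LM by (intro sets.Un) auto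
  have Edisj: "disjoint_family (E i)" for i
    unfolding disjoint_family_on_def
  proof (intro ballI impI)
    fix m n :: nat assume "m \<noteq> n"
    have *: "E i k \<inter> E i l = {}" if "k < l" for k l
    proof -
      have "x \<in> D (Suc k) \<and> f i x \<in> D (Suc k)" if "x \<in> E i k" for x
        using that Dmono[of k "Suc k"] by (auto simp: E_def L_def)
      moreover have "\<not> (x \<in> D l \<and> f i x \<in> D l)" if "x \<in> E i l" for x
        using that by (auto simp: E_def L_def)
      moreover have "D (Suc k) \<subseteq> D l" using that by (intro Dmono) simp
      ultimately show ?thesis by blast
    qed
    show "E i m \<inter> E i n = {}" using *[of m n] *[of n m] \<open>m \<noteq> n\<close> by (cases "m < n") auto
  qed
  have Lbound: "emeasure M (L n) \<le> (\<Sum>i. if i \<in> I then emeasure M (E i n) else 0)" for n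
  proof -
    define P where "P = (\<lambda>i. {x \<in> D n \<inter> src i. f i x \<in> L n})"
    define Q where "Q = (\<lambda>i. {x \<in> L n \<inter> src i. f i x \<in> D n})"
    define W where "W = (\<lambda>i. if i \<in> I then f i ` P i \<union> Q i else {})"
    have PM: "P i \<in> sets M" "P i \<subseteq> src i" and QM: "Q i \<in> sets M" if "i \<in> I" for i
      using EM1[OF that] DM LM by (auto simp: P_def Q_def)
    have PI: "f i ` P i \<in> sets M" "emeasure M (f i ` P i) = emeasure M (P i)" if "i \<in> I" for i
      using measure_preserving_iso_image[OF iso[OF that] PM[OF that]] .
    have WM: "W i \<in> sets M" for i using PI(1) QM by (auto simp: W_def)
    have "L n \<subseteq> (\<Union>i. W i)"
    proof
      fix y assume y: "y \<in> L n"
      then have "y \<in> N (D n)" "y \<notin> D n" by (auto simp: L_def DS)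
      then obtain i where i: "i \<in> I" "y \<in> f i ` (D n \<inter> src i) \<union> {x \<in> src i. f i x \<in> D n}"
        by (auto simp: N_def)
      then have "y \<in> W i" using y by (auto simp: W_def P_def Q_def)
      then show "y \<in> (\<Union>i. W i)" by blast
    qed
    then have "emeasure M (L n) \<le> emeasure M (\<Union>i. W i)" using WM by (intro emeasure_mono) auto
    also have "\<dots> \<le> (\<Sum>i. emeasure M (W i))" using WM by (intro emeasure_subadditive_countably) auto
    also have "\<dots> \<le> (\<Sum>i. if i \<in> I then emeasure M (E i n) else 0)"
    proof (intro suminf_le)
      fix i
      show "emeasure M (W i) \<le> (if i \<in> I then emeasure M (E i n) else 0)"
      proof (cases "i \<in> I")
        case True
        have "emeasure M (W i) \<le> emeasure M (f i ` P i) + emeasure M (Q i)"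
          using True PI(1) QM by (simp add: W_def emeasure_subadditive)
        also have "\<dots> = emeasure M (P i) + emeasure M (Q i)"
          using PI(2)[OF True] by simp
        also have "\<dots> = emeasure M (P i \<union> Q i)"
          using PM QM True by (intro plus_emeasure) (auto simp: P_def Q_def L_def)
        also have "P i \<union> Q i = E i n" by (simp add: P_def Q_def E_def)
        finally show ?thesis using True by simp
      qed (simp add: W_def)
    qed auto
    finally show ?thesis .
  qed
  have reachD: "y \<in> (\<Union>n. D n)" if "x \<in> A" "(y, x) \<in> (graphing_edges \<Phi> \<union> (graphing_edges \<Phi>)\<inverse>)\<^sup>*" for x y
    using that(2)
  proof (induction rule: converse_rtrancl_induct)
    case base then show ?case using that(1) D0 by blast
  next
    case (step y z)
    then obtain n where n: "z \<in> D n" by blast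
    have "y \<in> N (D n)"
      using step(1) n by (fastforce simp: N_def graphing_edges_def I_def src_def f_def)
    then show ?case using DS by blast
  qed
  have "AE x in M. x \<in> (\<Union>n. D n)"
    using reach by eventually_elim (use reachD in \<open>fastforce simp: graphing_component_def\<close>)
  then have "emeasure M (space M - A) = emeasure M (\<Union>n. L n)"
  proof (intro emeasure_eq_AE)
    have *: "(\<Union>n. D n) - A = (\<Union>n. L n)"
    proof
      show "(\<Union>n. D n) - A \<subseteq> (\<Union>n. L n)"
      proof clarify
        fix x n assume "x \<in> D n" "x \<notin> A"
        then show "x \<in> (\<Union>n. L n)" by (induction n) (auto simp: D0 L_def)
      qed
      show "(\<Union>n. L n) \<subseteq> (\<Union>n. D n) - A" using Dmono[of 0] D0 by (auto simp: L_def)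
    qed
    assume "AE x in M. x \<in> (\<Union>n. D n)"
    then show "AE x in M. (x \<in> space M - A) = (x \<in> (\<Union>n. L n))"
      using AE_space by eventually_elim (use * in blast)
  qed (use A LM in auto)
  also have "\<dots> \<le> (\<Sum>n. emeasure M (L n))" using LM by (intro emeasure_subadditive_countably) auto
  also have "\<dots> \<le> (\<Sum>n. \<Sum>i. if i \<in> I then emeasure M (E i n) else 0)"
    by (intro suminf_le Lbound) auto
  also have "\<dots> = (\<Sum>i. \<Sum>n. if i \<in> I then emeasure M (E i n) else 0)" by (rule suminf_ennreal_swap)
  also have "\<dots> \<le> (\<Sum>i. if i \<in> I then emeasure M (src i) else 0)"
  proof (intro suminf_le)
    fix i
    show "(\<Sum>n. if i \<in> I then emeasure M (E i n) else 0) \<le> (if i \<in> I then emeasure M (src i) else 0)"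
    proof (cases "i \<in> I")
      case True
      have "(\<Sum>n. emeasure M (E i n)) = emeasure M (\<Union>n. E i n)"
        using EM[OF True] by (intro suminf_emeasure Edisj) auto
      also have "\<dots> \<le> emeasure M (src i)"
        using srcM[OF True] by (intro emeasure_mono) (auto simp: E_def)
      finally show ?thesis using True by simp
    qed simp
  qed auto
  also have "\<dots> = graphing_cost M \<Phi>"
    unfolding graphing_cost_def infsum_ennreal_eq_suminf I_def src_def ..
  finally show ?thesis .
qed

section \<open>Essentially free actions\<close>

locale free_pmp_action = group G for G (structure) +
  fixes M :: "'x measure" and \<phi> :: "'a \<Rightarrow> 'x \<Rightarrow> 'x"
  assumes standard: "standard_prob_space M"
    and pmp: "pmp_action G M \<phi>"
    and free: "essentially_free G M \<phi>"
    and countable_group: "countable (carrier G)"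
begin

sublocale prob_space M
  using standard by (simp add: standard_prob_space_def)

sublocale action: group_action G "space M" \<phi>
  using pmp by (simp add: pmp_action_def)

lemma act_closed [simp]: "g \<in> carrier G \<Longrightarrow> x \<in> space M \<Longrightarrow> \<phi> g x \<in> space M"
  using action.element_image by blast

lemma act_mult: "g \<in> carrier G \<Longrightarrow> h \<in> carrier G \<Longrightarrow> x \<in> space M \<Longrightarrow> \<phi> (g \<otimes> h) x = \<phi> g (\<phi> h x)"
  by (rule action.composition_rule)

lemma act_one [simp]: "x \<in> space M \<Longrightarrow> \<phi> \<one> x = x"
  using action.id_eq_one by (metis restrict_apply)

lemma act_inv [simp]:
  assumes "g \<in> carrier G" "x \<in> space M"
  shows "\<phi> (inv g) (\<phi> g x) = x" "\<phi> g (\<phi> (inv g) x) = x"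
  using act_mult[of "inv g" g x] act_mult[of g "inv g" x] assms by simp_all

lemma act_vimage:
  assumes "g \<in> carrier G" "A \<in> sets M"
  shows "\<phi> g -` A \<inter> space M \<in> sets M" "emeasure M (\<phi> g -` A \<inter> space M) = emeasure M A"
proof -
  have m: "\<phi> g \<in> measurable M M" "distr M M (\<phi> g) = M"
    using pmp assms(1) by (auto simp: pmp_action_def)
  show "\<phi> g -` A \<inter> space M \<in> sets M" using measurable_sets[OF m(1) assms(2)] .
  show "emeasure M (\<phi> g -` A \<inter> space M) = emeasure M A"
    using emeasure_distr[OF m(1) assms(2)] m(2) by simp
qed

lemma act_image_eq:
  assumes "g \<in> carrier G" "A \<in> sets M"
  shows "\<phi> g ` A = \<phi> (inv g) -` A \<inter> space M"
proof
  have A: "A \<subseteq> space M" using assms(2) by (rule sets.sets_into_space)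
  then show "\<phi> g ` A \<subseteq> \<phi> (inv g) -` A \<inter> space M" using assms(1) by (auto simp: subset_iff)
  show "\<phi> (inv g) -` A \<inter> space M \<subseteq> \<phi> g ` A"
  proof
    fix x assume "x \<in> \<phi> (inv g) -` A \<inter> space M"
    then show "x \<in> \<phi> g ` A" using assms(1) by (intro image_eqI[of _ _ "\<phi> (inv g) x"]) auto
  qed
qed

lemma act_image:
  assumes "g \<in> carrier G" "A \<in> sets M"
  shows "\<phi> g ` A \<in> sets M" "emeasure M (\<phi> g ` A) = emeasure M A"
  using act_vimage[of "inv g" A] assms by (simp_all add: act_image_eq)

lemma measure_preserving_iso_act:
  assumes g: "g \<in> carrier G" and A: "A \<in> sets M"
  shows "measure_preserving_iso M A (\<phi> g ` A) (\<phi> g)"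
proof -
  let ?B = "\<phi> g ` A"
  have B: "?B \<in> sets M" using act_image[OF g A] by simp
  have As: "A \<subseteq> space M" using A by (rule sets.sets_into_space)
  have inj: "inj_on (\<phi> g) A" using action.inj_prop[OF g] As by (rule inj_on_subset)
  have gm: "\<phi> g \<in> measurable M M" and im: "\<phi> (inv g) \<in> measurable M M"
    using pmp g by (auto simp: pmp_action_def)
  have m: "\<phi> g \<in> measurable (restrict_space M A) (restrict_space M ?B)"
    using A by (intro measurable_restrict_space2 measurable_restrict_space1 gm) auto
  have "\<phi> (inv g) \<in> measurable (restrict_space M ?B) (restrict_space M A)"
    using B A As g by (intro measurable_restrict_space2 measurable_restrict_space1 im) (auto simp: subset_iff)
  moreover have "inv_into A (\<phi> g) y = \<phi> (inv g) y" if "y \<in> ?B" for y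
    using that inj As g by (auto simp: inv_into_f_f subset_iff)
  ultimately have mi: "inv_into A (\<phi> g) \<in> measurable (restrict_space M ?B) (restrict_space M A)"
    using B by (subst measurable_cong[where g = "\<phi> (inv g)"]) auto
  have "distr (restrict_space M A) (restrict_space M ?B) (\<phi> g) = restrict_space M ?B"
  proof (rule measure_eqI)
    fix C assume "C \<in> sets (distr (restrict_space M A) (restrict_space M ?B) (\<phi> g))"
    then have Cr: "C \<in> sets (restrict_space M ?B)" by simp
    then have C: "C \<in> sets M" "C \<subseteq> ?B" using B by (auto simp: sets_restrict_space_iff)
    have eq: "\<phi> g -` C \<inter> A = \<phi> g -` C \<inter> space M"
    proof
      show "\<phi> g -` C \<inter> space M \<subseteq> \<phi> g -` C \<inter> A"
      proof clarify
        fix x assume x: "\<phi> g x \<in> C" "x \<in> space M"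
        then obtain a where "a \<in> A" "\<phi> g x = \<phi> g a" using C by blast
        then show "x \<in> \<phi> g -` C \<inter> A" using x As inj_onD[OF action.inj_prop[OF g]] by (auto simp: subset_iff)
      qed
    qed (use As in auto)
    have "emeasure (distr (restrict_space M A) (restrict_space M ?B) (\<phi> g)) C
        = emeasure (restrict_space M A) (\<phi> g -` C \<inter> A)"
      using emeasure_distr[OF m Cr] A by simp
    also have "\<dots> = emeasure M (\<phi> g -` C \<inter> A)" using A by (simp add: emeasure_restrict_space)
    also have "\<dots> = emeasure M C" using act_vimage[OF g C(1)] by (simp add: eq)
    also have "\<dots> = emeasure (restrict_space M ?B) C" using B C by (simp add: emeasure_restrict_space)
    finally show "emeasure (distr (restrict_space M A) (restrict_space M ?B) (\<phi> g)) C
        = emeasure (restrict_space M ?B) C" .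
  qed simp
  then show ?thesis using A B m mi inj by (simp add: measure_preserving_iso_def inj_on_imp_bij_betw)
qed

text \<open>
  Almost every \<open>x\<close> is moved by \<open>q\<close>, so some set of a countable separating family contains \<open>x\<close> but
  not its image under \<open>q\<close>. This splits \<open>C\<close>, up to a null set, into countably many pieces that are
  disjoint from their images, and one of them has positive measure.
\<close>

lemma disjoint_translate:
  assumes C: "C \<in> sets M" "0 < measure M C" and q: "q \<in> carrier G" "q \<noteq> \<one>"
  shows "\<exists>B\<in>sets M. B \<subseteq> C \<and> 0 < measure M B \<and> (\<forall>x\<in>B. \<phi> q x \<notin> B)"
proof -
  obtain D :: "nat \<Rightarrow> 'x set" where D: "\<And>n. D n \<in> sets M"
    "\<And>x y. x \<in> space M \<Longrightarrow> y \<in> space M \<Longrightarrow> x \<noteq> y \<Longrightarrow> \<exists>n. x \<in> D n \<and> y \<notin> D n"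
    using standard_borel_separating standard unfolding standard_prob_space_def by metis
  define B where "B = (\<lambda>n. C \<inter> D n - (\<phi> q -` D n \<inter> space M))"
  have BM: "B n \<in> sets M" for n using C D act_vimage(1)[OF q(1) D(1)] by (auto simp: B_def)
  have Cs: "C \<subseteq> space M" using C(1) by (rule sets.sets_into_space)
  have "AE x in M. x \<in> C \<longrightarrow> x \<in> (\<Union>n. B n)"
    using free AE_space unfolding essentially_free_def
  proof eventually_elim
    case (elim x)
    have "\<phi> q x \<noteq> x" using elim(1) q unfolding stabilizer_def by auto
    then show ?case using D(2)[of x "\<phi> q x"] elim(2) q by (auto simp: B_def)
  qed
  then have "emeasure M C \<le> emeasure M (\<Union>n. B n)"
    using BM by (intro emeasure_mono_AE) auto
  moreover have "emeasure M C \<noteq> 0" using C(2) by (simp add: emeasure_eq_measure)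
  ultimately have "emeasure M (\<Union>n. B n) \<noteq> 0" by auto
  then obtain n where "emeasure M (B n) \<noteq> 0" using emeasure_UN_eq_0[of M B] BM by auto
  then have "0 < measure M (B n)" by (simp add: emeasure_eq_measure zero_less_measure_iff less_le)
  moreover have "\<phi> q x \<notin> B n" if "x \<in> B n" for x using that Cs by (auto simp: B_def)
  ultimately show ?thesis using BM by (intro bexI[of _ "B n"]) (auto simp: B_def)
qed

lemma disjoint_translates:
  assumes C: "C \<in> sets M" "0 < measure M C" and P: "finite P" "P \<subseteq> carrier G"
  shows "\<exists>B\<in>sets M. B \<subseteq> C \<and> 0 < measure M B \<and> disjoint_family_on (\<lambda>p. \<phi> p ` B) P"
proof -
  have sep: "\<exists>B\<in>sets M. B \<subseteq> C \<and> 0 < measure M B \<and> (\<forall>q\<in>Q. \<forall>x\<in>B. \<phi> q x \<notin> B)"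
    if "finite Q" "Q \<subseteq> carrier G - {\<one>}" for Q
    using that
  proof (induction Q)
    case empty then show ?case using C by blast
  next
    case (insert q Q)
    then obtain B where B: "B \<in> sets M" "B \<subseteq> C" "0 < measure M B" "\<forall>q\<in>Q. \<forall>x\<in>B. \<phi> q x \<notin> B" by auto
    obtain B' where "B' \<in> sets M" "B' \<subseteq> B" "0 < measure M B'" "\<forall>x\<in>B'. \<phi> q x \<notin> B'"
      using disjoint_translate[OF B(1,3), of q] insert.prems by auto
    then show ?case using B by (intro bexI[of _ B']) blast+
  qed
  define Q where "Q = (\<lambda>(p, r). inv p \<otimes> r) ` (P \<times> P) - {\<one>}"
  have "finite Q" "Q \<subseteq> carrier G - {\<one>}" using P by (auto simp: Q_def subset_iff)
  then obtain B where B: "B \<in> sets M" "B \<subseteq> C" "0 < measure M B" "\<forall>q\<in>Q. \<forall>x\<in>B. \<phi> q x \<notin> B"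
    using sep[of Q] by blast
  have Bs: "B \<subseteq> space M" using B(1) by (rule sets.sets_into_space)
  have "disjoint_family_on (\<lambda>p. \<phi> p ` B) P"
    unfolding disjoint_family_on_def
  proof (intro ballI impI, rule ccontr)
    fix p r assume pr: "p \<in> P" "r \<in> P" "p \<noteq> r" "\<phi> p ` B \<inter> \<phi> r ` B \<noteq> {}"
    then obtain a b where ab: "a \<in> B" "b \<in> B" "\<phi> p a = \<phi> r b" by auto
    have c: "p \<in> carrier G" "r \<in> carrier G" "a \<in> space M" "b \<in> space M" using pr ab P Bs by auto
    have "inv p \<otimes> r \<noteq> \<one>" using c pr(3) by (metis inv_equality inv_inv inv_closed)
    then have "inv p \<otimes> r \<in> Q" using pr by (auto simp: Q_def)
    moreover have "\<phi> (inv p \<otimes> r) b = a" using c by (simp add: act_mult ab(3)[symmetric])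
    ultimately show False using B(4) ab by auto
  qed
  then show ?thesis using B by blast
qed

lemma measure_UN_translates:
  assumes "B \<in> sets M" "finite P" "P \<subseteq> carrier G" "disjoint_family_on (\<lambda>p. \<phi> p ` B) P"
  shows "emeasure M (\<Union>p\<in>P. \<phi> p ` B) = of_nat (card P) * emeasure M B"
proof -
  have "(\<Sum>p\<in>P. emeasure M (\<phi> p ` B)) = emeasure M (\<Union>p\<in>P. \<phi> p ` B)"
    using assms act_image(1) by (intro sum_emeasure) auto
  moreover have "(\<Sum>p\<in>P. emeasure M (\<phi> p ` B)) = (\<Sum>p\<in>P. emeasure M B)"
    using assms act_image(2) by (intro sum.cong) auto
  ultimately show ?thesis by simp
qed

section \<open>Small complete sections\<close>

definition invariant :: "'x set \<Rightarrow> bool" where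
  "invariant Y \<longleftrightarrow> (\<forall>g\<in>carrier G. \<forall>x\<in>Y. \<phi> g x \<in> Y)"

text \<open>
  A set of positive measure with \<open>N\<close> disjoint translates meets all orbits of its saturation while
  having at most \<open>1 / N\<close> of the measure of the saturation. Exhaust the space by such saturations; the
  part not yet treated stays invariant.
\<close>

lemma small_complete_section:
  assumes inf: "infinite (carrier G)" and N: "0 < (N::nat)"
  shows "\<exists>A\<in>sets M. of_nat N * emeasure M A \<le> 1 \<and> (AE x in M. \<exists>g\<in>carrier G. \<phi> g x \<in> A)"
proof -
  define R where "R = (\<lambda>Y Z. Y \<in> sets M \<and> Z \<in> sets M \<and> Z \<subseteq> Y \<and> (invariant Y \<longrightarrow> invariant Z) \<and>
    (\<exists>A\<in>sets M. of_nat N * emeasure M A \<le> emeasure M (Y - Z) \<and>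
      (\<forall>x\<in>Y - Z. \<exists>g\<in>carrier G. \<phi> g x \<in> A)))"
  have invs: "invariant (space M)" by (simp add: invariant_def)
  have "\<exists>Y. R (space M) Y \<and> measure M Y = 0"
  proof (rule exhaustion)
    show "R Y Y" if "Y \<in> sets M" for Y using that by (auto simp: R_def)
    show "Z \<in> sets M \<and> Z \<subseteq> Y" if "R Y Z" for Y Z using that by (simp add: R_def)
  next
    fix Y :: "nat \<Rightarrow> 'x set" assume step: "\<And>n. R (Y n) (Y (Suc n))"
    have YM: "Y n \<in> sets M" and Ydec: "Y (Suc n) \<subseteq> Y n" for n using step[of n] by (auto simp: R_def)
    have "\<exists>A\<in>sets M. of_nat N * emeasure M A \<le> emeasure M (Y n - Y (Suc n)) \<and>
        (\<forall>x\<in>Y n - Y (Suc n). \<exists>g\<in>carrier G. \<phi> g x \<in> A)" for n using step[of n] by (simp add: R_def)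
    then obtain A where A: "\<And>n. A n \<in> sets M"
      "\<And>n. of_nat N * emeasure M (A n) \<le> emeasure M (Y n - Y (Suc n))"
      "\<And>n x. x \<in> Y n - Y (Suc n) \<Longrightarrow> \<exists>g\<in>carrier G. \<phi> g x \<in> A n" by metis
    have "of_nat N * emeasure M (\<Union>n. A n) \<le> of_nat N * (\<Sum>n. emeasure M (A n))"
      using A(1) by (intro mult_left_mono emeasure_subadditive_countably) auto
    also have "\<dots> = (\<Sum>n. of_nat N * emeasure M (A n))" by simp
    also have "\<dots> \<le> (\<Sum>n. emeasure M (Y n - Y (Suc n)))" by (intro suminf_le A(2)) auto
    also have "\<dots> = emeasure M (Y 0 - (\<Inter>n. Y n))" using YM Ydec by (rule emeasure_decrement_sum)
    finally have c: "of_nat N * emeasure M (\<Union>n. A n) \<le> emeasure M (Y 0 - (\<Inter>n. Y n))" .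
    have "\<exists>g\<in>carrier G. \<phi> g x \<in> (\<Union>n. A n)" if x: "x \<in> Y 0 - (\<Inter>n. Y n)" for x
    proof -
      have "\<exists>n. x \<in> Y n - Y (Suc n)"
      proof (rule ccontr)
        assume neg: "\<not> ?thesis"
        have "x \<in> Y n" for n by (induction n) (use x neg in auto)
        then show False using x by blast
      qed
      then obtain n where "x \<in> Y n - Y (Suc n)" ..
      from A(3)[OF this] show ?thesis by blast
    qed
    moreover have "invariant (\<Inter>n. Y n)" if "invariant (Y 0)"
    proof -
      have "invariant (Y n)" for n by (induction n) (use that step in \<open>auto simp: R_def\<close>)
      then show ?thesis by (auto simp: invariant_def)
    qed
    ultimately show "R (Y 0) (\<Inter>n. Y n)"
      unfolding R_def using YM A(1) c by (intro conjI bexI[of _ "\<Union>n. A n"]) auto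
  next
    fix Y assume RY: "R (space M) Y" and pos: "0 < measure M Y"
    have YM: "Y \<in> sets M" and inv: "invariant Y" using RY invs by (auto simp: R_def)
    have Ys: "Y \<subseteq> space M" using YM by (rule sets.sets_into_space)
    obtain P where P: "P \<subseteq> carrier G" "finite P" "card P = N"
      using infinite_arbitrarily_large[OF inf] by metis
    obtain B where B: "B \<in> sets M" "B \<subseteq> Y" "0 < measure M B" "disjoint_family_on (\<lambda>p. \<phi> p ` B) P"
      using disjoint_translates[OF YM pos P(2,1)] by blast
    define W where "W = (\<Union>g\<in>carrier G. \<phi> g ` B)"
    have WM: "W \<in> sets M" unfolding W_def
      using countable_group act_image(1) B(1) by (intro sets.countable_UN') auto
    have WY: "W \<subseteq> Y" using inv B(2) by (auto simp: W_def invariant_def)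
    have "of_nat N * emeasure M B = emeasure M (\<Union>p\<in>P. \<phi> p ` B)"
      using measure_UN_translates[OF B(1) P(2,1) B(4)] P(3) by simp
    also have "\<dots> \<le> emeasure M W" using WM P(1) by (intro emeasure_mono) (auto simp: W_def)
    finally have NB: "of_nat N * emeasure M B \<le> emeasure M W" .
    have YW: "Y - (Y - W) = W" using WY by blast
    have "0 < measure M W"
    proof -
      have "B \<subseteq> W" using B(2) Ys by (force simp: W_def intro: bexI[of _ \<one>])
      then show ?thesis using B(3) finite_measure_mono[OF _ WM, of B] by linarith
    qed
    then have "measure M (Y - W) < measure M Y" using finite_measure_Diff[OF YM WM WY] by simp
    moreover have "R Y (Y - W)"
    proof -
      have "invariant (Y - W)"
        unfolding invariant_def
      proof (intro ballI DiffI)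
        fix g x assume g: "g \<in> carrier G" and x: "x \<in> Y - W"
        then show "\<phi> g x \<in> Y" using inv by (auto simp: invariant_def)
        show "\<phi> g x \<notin> W"
        proof
          assume "\<phi> g x \<in> W"
          then obtain h b where h: "h \<in> carrier G" "b \<in> B" "\<phi> g x = \<phi> h b" by (auto simp: W_def)
          have "x = \<phi> (inv g \<otimes> h) b"
            using g x h Ys B(2) by (subst act_mult) (auto simp: subset_iff h(3)[symmetric])
          then show False using x g h by (auto simp: W_def)
        qed
      qed
      moreover have "\<exists>g\<in>carrier G. \<phi> g x \<in> B" if "x \<in> W" for x
      proof -
        obtain g b where "g \<in> carrier G" "b \<in> B" "x = \<phi> g b" using \<open>x \<in> W\<close> by (auto simp: W_def)
        then show ?thesis using B(2) Ys by (intro bexI[of _ "inv g"]) (auto simp: subset_iff)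
      qed
      ultimately show ?thesis unfolding R_def YW using YM WM NB B(1) by auto
    qed
    ultimately show "\<exists>Z. R Y Z \<and> measure M Z < measure M Y" by blast
  qed
  then obtain Y where RY: "R (space M) Y" and Y0: "measure M Y = 0" by blast
  then obtain A where A: "A \<in> sets M" "of_nat N * emeasure M A \<le> emeasure M (space M - Y)"
    "\<forall>x\<in>space M - Y. \<exists>g\<in>carrier G. \<phi> g x \<in> A" by (auto simp: R_def)
  have "Y \<in> null_sets M" using RY Y0 by (auto simp: R_def emeasure_eq_measure)
  then have "AE x in M. x \<notin> Y" by (rule AE_not_in)
  then have "AE x in M. \<exists>g\<in>carrier G. \<phi> g x \<in> A"
    using AE_space by eventually_elim (use A(3) in blast)
  moreover have "of_nat N * emeasure M A \<le> 1"
    using A(2) emeasure_le_1[of "space M - Y"] by (rule order_trans)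
  ultimately show ?thesis using A(1) by blast
qed

lemma cost_ge_1:
  assumes inf: "infinite (carrier G)"
  shows "1 \<le> cost M (orbit_relation G M \<phi>)"
  unfolding cost_def
proof (rule Inf_greatest, clarify)
  fix \<Phi> assume gr: "graphing M (orbit_relation G M \<phi>) \<Phi>" and gen: "generates M (orbit_relation G M \<phi>) \<Phi>"
  show "1 \<le> graphing_cost M \<Phi>"
  proof (rule ennreal_le_epsilon)
    fix e :: real assume e: "0 < e"
    obtain N where N: "inverse (real (Suc N)) < e" using reals_Archimedean[OF e] by blast
    obtain A where A: "A \<in> sets M" "of_nat (Suc N) * emeasure M A \<le> 1"
      "AE x in M. \<exists>g\<in>carrier G. \<phi> g x \<in> A"
      using small_complete_section[OF inf, of "Suc N"] by auto
    have "real (Suc N) * measure M A \<le> 1"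
      using A(2) unfolding emeasure_eq_measure ennreal_of_nat_eq_real_of_nat
      by (simp flip: ennreal_mult del: of_nat_Suc)
    then have "measure M A \<le> inverse (real (Suc N))" by (simp add: field_simps del: of_nat_Suc)
    then have Ae: "emeasure M A \<le> ennreal e" using N unfolding emeasure_eq_measure by (intro ennreal_leI) linarith
    have "AE x in M. graphing_component \<Phi> x \<inter> A \<noteq> {}"
      using gen[unfolded generates_def] A(3) AE_space
    proof eventually_elim
      case (elim x)
      then obtain g where "g \<in> carrier G" "\<phi> g x \<in> A" by blast
      then have "\<phi> g x \<in> orbit_relation G M \<phi> `` {x} \<inter> A"
        using elim(3) by (auto simp: orbit_relation_def orbit_def)
      then show ?case using elim(1) by blast
    qed
    then have "emeasure M (space M - A) \<le> graphing_cost M \<Phi>"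
      using gr by (intro graphing_cost_ge_complement_of_section A(1)) (auto simp: graphing_def)
    moreover have "1 = emeasure M (space M - A) + emeasure M A"
      using emeasure_compl[OF A(1)] A(1) emeasure_space_1
      by (metis Diff_disjoint Diff_partition inf_commute plus_emeasure sets.compl_sets sets.sets_into_space sup_commute)
    ultimately show "1 \<le> graphing_cost M \<Phi> + ennreal e" using Ae by (metis add_mono)
  qed
qed

section \<open>Exhaustion by Folner tiles\<close>

text \<open>
  A family of sets \<open>A g\<close> indexed by the group encodes the graphing that consists of the restrictions
  of the maps \<open>\<phi> g\<close> to the sets \<open>A g\<close>.
\<close>

definition connected_by :: "('a \<Rightarrow> 'x set) \<Rightarrow> ('x \<times> 'x) set" where
  "connected_by A = (let E = {(x, \<phi> g x) | g x. g \<in> carrier G \<and> x \<in> A g} in (E \<union> E\<inverse>)\<^sup>*)"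

lemma connected_by_mono:
  assumes "\<And>g. g \<in> carrier G \<Longrightarrow> A g \<subseteq> B g"
  shows "connected_by A \<subseteq> connected_by B"
  unfolding connected_by_def Let_def by (intro rtrancl_mono Un_mono) (use assms in auto)

lemma connected_by_edge: "g \<in> carrier G \<Longrightarrow> x \<in> A g \<Longrightarrow> (x, \<phi> g x) \<in> connected_by A"
  unfolding connected_by_def Let_def by (intro r_into_rtrancl) auto

lemma connected_by_sym: "(x, y) \<in> connected_by A \<Longrightarrow> (y, x) \<in> connected_by A"
  unfolding connected_by_def Let_def
  by (meson symD sym_Un_converse sym_rtrancl)

lemma connected_by_trans:
  "(x, y) \<in> connected_by A \<Longrightarrow> (y, z) \<in> connected_by A \<Longrightarrow> (x, z) \<in> connected_by A"
  unfolding connected_by_def Let_def by (rule rtrancl_trans)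

text \<open>
  For a Folner set \<open>F\<close> and a random point \<open>x\<close>, the expected proportion of elements of \<open>F\<close> that move
  \<open>x\<close> into \<open>Y\<close> is the measure \<open>v\<close> of \<open>Y\<close>. Hence with positive probability the set \<open>P\<close> of these
  elements has at least half the expected size. As \<open>F\<close> has finitely many subsets, one \<open>P\<close> serves a
  set of positive measure, in which a base \<open>B\<close> with disjoint translates is chosen. An edge of \<open>Y\<close>
  that leaves the tile at \<open>x\<close> leaves the translate of \<open>x\<close> by \<open>F\<close>, and there are few such edges even
  in comparison with \<open>P\<close> if \<open>F\<close> is taken invariant enough relative to \<open>v\<close>.
\<close>

lemma folner_tile:
  assumes am: "amenable G" and S: "finite S" "S \<subseteq> carrier G" "\<one> \<in> S" and e: "0 < (e::real)"
    and Y: "Y \<in> sets M" "0 < measure M Y"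
  shows "\<exists>F P B. finite F \<and> F \<subseteq> carrier G \<and> P \<subseteq> F \<and> P \<noteq> {} \<and> B \<in> sets M \<and> 0 < measure M B \<and>
      (\<forall>x\<in>B. \<forall>g\<in>F. \<phi> g x \<in> Y \<longleftrightarrow> g \<in> P) \<and> disjoint_family_on (\<lambda>p. \<phi> p ` B) P \<and>
      real (\<Sum>s\<in>S. card {p\<in>P. s \<otimes> p \<notin> F}) \<le> e * card P"
proof -
  define v where "v = measure M Y"
  have v: "0 < v" using Y by (simp add: v_def)
  have cS: "0 < card S" using S by (auto simp: card_gt_0_iff)
  \<comment> \<open>The factor \<open>v / 2\<close> pays for the passage from \<open>F\<close> to \<open>P\<close>, and the factor \<open>1 / card S\<close> for the
    summation over \<open>S\<close>.\<close>
  define d where "d = e * (v / 2) / card S"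
  have d: "0 < d" using e v cS by (simp add: d_def)
  obtain F where F: "finite F" "F \<subseteq> carrier G" "F \<noteq> {}" "real (card (S <#> F)) \<le> (1 + d) * card F"
    using amenable_folner[OF am S(1,2) d] by blast
  have cF: "0 < card F" using F by (simp add: card_gt_0_iff)
  define X where "X = (\<lambda>P. {x \<in> space M. \<forall>g\<in>F. \<phi> g x \<in> Y \<longleftrightarrow> g \<in> P})"
  have XM: "X P \<in> sets M" for P
  proof -
    have "{x \<in> space M. \<phi> g x \<in> Y \<longleftrightarrow> g \<in> P} \<in> sets M" if "g \<in> F" for g
    proof -
      have "{x \<in> space M. \<phi> g x \<in> Y} \<in> sets M"
        using act_vimage(1)[of g Y] that F(2) Y(1) by (auto simp: vimage_def Int_def conj_commute)
      then show ?thesis by (cases "g \<in> P") (auto intro: sets.sets_Collect_neg)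
    qed
    then show ?thesis unfolding X_def using F(1) by (intro sets.sets_Collect_finite_All) auto
  qed
  \<comment> \<open>For a random point, the expected number of \<open>g\<close> in \<open>F\<close> with \<open>g x \<in> Y\<close> is \<open>card F * v\<close>.\<close>
  have "\<exists>P. P \<subseteq> F \<and> v / 2 * card F \<le> card P \<and> emeasure M (X P) \<noteq> 0"
  proof (rule ccontr)
    assume neg: "\<not> ?thesis"
    define \<P> where "\<P> = {P. P \<subseteq> F \<and> v / 2 * card F \<le> card P}"
    have fin: "finite \<P>" using F(1) by (simp add: \<P>_def)
    have "AE x in M. \<forall>P\<in>\<P>. x \<notin> X P"
      using neg XM by (intro AE_finite_allI[OF fin] AE_not_in) (auto simp: \<P>_def null_sets_def)
    then have "AE x in M. (\<Sum>g\<in>F. indicator (\<phi> g -` Y \<inter> space M) x) \<le> ennreal (v / 2 * card F)"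
      using AE_space
    proof eventually_elim
      case (elim x)
      let ?P = "{g\<in>F. \<phi> g x \<in> Y}"
      have "x \<in> X ?P" using elim(2) by (simp add: X_def)
      then have "?P \<notin> \<P>" using elim(1) by blast
      then have "card ?P < v / 2 * card F" by (simp add: \<P>_def not_le)
      moreover have "(\<Sum>g\<in>F. indicator (\<phi> g -` Y \<inter> space M) x) = (of_nat (card ?P) :: ennreal)"
        using elim(2) F(1) by (simp add: indicator_def sum.If_cases Int_def)
      ultimately show ?case by (simp add: ennreal_of_nat_eq_real_of_nat ennreal_leI)
    qed
    then have "(\<integral>\<^sup>+x. (\<Sum>g\<in>F. indicator (\<phi> g -` Y \<inter> space M) x) \<partial>M) \<le> (\<integral>\<^sup>+x. ennreal (v / 2 * card F) \<partial>M)"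
      by (rule nn_integral_mono_AE)
    also have "\<dots> = ennreal (v / 2 * card F)" by (simp add: emeasure_space_1)
    also have "(\<integral>\<^sup>+x. (\<Sum>g\<in>F. indicator (\<phi> g -` Y \<inter> space M) x) \<partial>M)
        = (\<Sum>g\<in>F. emeasure M (\<phi> g -` Y \<inter> space M))"
      using F(2) Y(1) act_vimage(1)
      by (subst nn_integral_sum) (auto intro!: sum.cong nn_integral_indicator)
    also have "\<dots> = (\<Sum>g\<in>F. ennreal v)"
      using F(2) Y(1) act_vimage(2) by (intro sum.cong) (auto simp: v_def emeasure_eq_measure)
    also have "\<dots> = ennreal (card F * v)" using v
      by (simp add: ennreal_of_nat_eq_real_of_nat ennreal_mult)
    finally have "card F * v \<le> v / 2 * card F" using v by simp
    then show False using v cF by (simp add: field_simps)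
  qed
  then obtain P where P: "P \<subseteq> F" "v / 2 * card F \<le> card P" "emeasure M (X P) \<noteq> 0" by blast
  have posX: "0 < measure M (X P)" using P(3) by (simp add: emeasure_eq_measure less_le)
  have finP: "finite P" "P \<subseteq> carrier G" using P(1) F finite_subset by auto
  obtain B where B: "B \<in> sets M" "B \<subseteq> X P" "0 < measure M B" "disjoint_family_on (\<lambda>p. \<phi> p ` B) P"
    using disjoint_translates[OF XM posX finP] by blast
  have "P \<noteq> {}"
  proof
    assume "P = {}"
    then have "v / 2 * card F \<le> 0" using P(2) by simp
    then show False using v cF by (simp add: mult_le_0_iff)
  qed
  have FSF: "F \<subseteq> S <#> F" using F(2) S(3) by (force simp: set_mult_def)
  have SFfin: "finite (S <#> F)" using S(1) F(1) by (rule finite_set_mult)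
  have "card {p\<in>P. s \<otimes> p \<notin> F} \<le> card ((S <#> F) - F)" if s: "s \<in> S" for s
  proof (rule card_inj_on_le)
    show "inj_on (\<lambda>p. s \<otimes> p) {p\<in>P. s \<otimes> p \<notin> F}"
      using s S(2) finP(2) by (auto simp: inj_on_def subset_iff)
    show "(\<lambda>p. s \<otimes> p) ` {p\<in>P. s \<otimes> p \<notin> F} \<subseteq> (S <#> F) - F"
      using s P(1) by (auto simp: set_mult_def)
  qed (use SFfin in auto)
  then have "(\<Sum>s\<in>S. card {p\<in>P. s \<otimes> p \<notin> F}) \<le> card S * card ((S <#> F) - F)"
    using sum_bounded_above[of S "\<lambda>s. card {p\<in>P. s \<otimes> p \<notin> F}" "card ((S <#> F) - F)"] by simp
  also have "card ((S <#> F) - F) = card (S <#> F) - card F"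
    using FSF F(1) by (intro card_Diff_subset) auto
  finally have "real (\<Sum>s\<in>S. card {p\<in>P. s \<otimes> p \<notin> F}) \<le> real (card S * (card (S <#> F) - card F))"
    by (rule of_nat_mono)
  also have "\<dots> = card S * (real (card (S <#> F)) - card F)"
    using card_mono[OF SFfin FSF] by (simp add: of_nat_diff)
  also have "\<dots> \<le> card S * (d * card F)"
    using F(4) by (intro mult_left_mono) (auto simp: algebra_simps)
  also have "\<dots> = e * (v / 2 * card F)" using cS by (simp add: d_def)
  also have "\<dots> \<le> e * card P" using P(2) e by (intro mult_left_mono) auto
  finally have "real (\<Sum>s\<in>S. card {p\<in>P. s \<otimes> p \<notin> F}) \<le> e * card P" .
  moreover have "\<phi> g x \<in> Y \<longleftrightarrow> g \<in> P" if "x \<in> B" "g \<in> F" for x g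
    using that B(2) by (auto simp: X_def)
  ultimately show ?thesis using F B P(1) \<open>P \<noteq> {}\<close> by blast
qed

text \<open>
  Removing \<open>Y - Z\<close> from \<open>Y\<close> is paid for by a graphing that connects all edges of the Schreier graph
  inside \<open>Y\<close> that do not stay inside \<open>Z\<close>. The price is measured relative to the removed part, so that
  the prices of successive removals add up.
\<close>

definition cheaply_connects :: "'a set \<Rightarrow> real \<Rightarrow> 'x set \<Rightarrow> 'x set \<Rightarrow> bool" where
  "cheaply_connects S e Y Z \<longleftrightarrow> Y \<in> sets M \<and> Z \<in> sets M \<and> Z \<subseteq> Y \<and>
    (\<exists>A. (\<forall>g\<in>carrier G. A g \<in> sets M) \<and>
      (\<integral>\<^sup>+g. emeasure M (A g) \<partial>count_space (carrier G)) \<le> ennreal (1 + e) * emeasure M (Y - Z) \<and>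
      (\<forall>s\<in>S. \<forall>x\<in>Y. \<phi> s x \<in> Y \<longrightarrow> (x \<in> Z \<and> \<phi> s x \<in> Z) \<or> (x, \<phi> s x) \<in> connected_by A))"

text \<open>
  Remove the tiles from \<open>Y\<close>. A star joins the base point \<open>b\<close>, which need not lie in \<open>Y\<close>, to the points
  \<open>\<phi> p b\<close> of its tile and costs exactly the measure of the tiles. The edges from a tile to another
  point of \<open>Y\<close> are added one by one, and \<open>folner_tile\<close> makes them cost at most \<open>e\<close> times the measure
  of the tiles.
\<close>

lemma cheaply_connects_tile:
  assumes am: "amenable G" and S: "finite S" "S \<subseteq> carrier G" "\<one> \<in> S" "set_inv S = S" and e: "0 < e"
    and Y: "Y \<in> sets M" "0 < measure M Y"
  shows "\<exists>Z. cheaply_connects S e Y Z \<and> measure M Z < measure M Y"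
proof -
  obtain F P B where F: "finite F" "F \<subseteq> carrier G" and P: "P \<subseteq> F" "P \<noteq> {}"
    and B: "B \<in> sets M" "0 < measure M B"
    and PY: "\<And>x g. x \<in> B \<Longrightarrow> g \<in> F \<Longrightarrow> \<phi> g x \<in> Y \<longleftrightarrow> g \<in> P"
    and disj: "disjoint_family_on (\<lambda>p. \<phi> p ` B) P"
    and bd: "real (\<Sum>s\<in>S. card {p\<in>P. s \<otimes> p \<notin> F}) \<le> e * card P"
    using folner_tile[OF am S(1-3) e Y] by blast
  have finP: "finite P" "P \<subseteq> carrier G" using P F finite_subset by auto
  have Bs: "B \<subseteq> space M" and Ys: "Y \<subseteq> space M" using B(1) Y(1) sets.sets_into_space by auto
  define W where "W = (\<Union>p\<in>P. \<phi> p ` B)"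
  have pM: "\<phi> p ` B \<in> sets M" if "p \<in> P" for p using act_image(1)[OF _ B(1)] that finP by auto
  have WM: "W \<in> sets M" using pM finP unfolding W_def by (intro sets.finite_UN) auto
  have WY: "W \<subseteq> Y" using PY P(1) by (auto simp: W_def)
  have eW: "emeasure M W = ennreal (card P * measure M B)"
    using measure_UN_translates[OF B(1) finP disj]
    by (simp add: W_def emeasure_eq_measure ennreal_mult ennreal_of_nat_eq_real_of_nat)
  have "0 < measure M W"
  proof -
    have "measure M W = card P * measure M B"
      using eW by (simp add: emeasure_eq_measure)
    then show ?thesis using B(2) P(2) finP by (simp add: card_gt_0_iff)
  qed
  then have less: "measure M (Y - W) < measure M Y"
    using finite_measure_Diff[OF Y(1) WM WY] by simp
  have YW: "Y - (Y - W) = W" using WY by blast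
  \<comment> \<open>\<open>c g\<close> lists the positions in the tile at which the generator \<open>g\<close> leads out of the Folner set.\<close>
  define c where "c = (\<lambda>g. if g \<in> S then {p\<in>P. g \<otimes> p \<notin> F} else {})"
  define A where "A = (\<lambda>g. (if g \<in> P then B else {}) \<union> (\<Union>p\<in>c g. \<phi> p ` B))"
  have cP: "c g \<subseteq> P" "finite (c g)" for g using finP(1) by (auto simp: c_def)
  have AM: "A g \<in> sets M" for g
  proof -
    have "(\<Union>p\<in>c g. \<phi> p ` B) \<in> sets M" using cP pM by (intro sets.finite_UN) auto
    then show ?thesis using B(1) by (auto simp: A_def)
  qed
  have eA: "emeasure M (A g) \<le> ennreal (((if g \<in> P then 1 else 0) + card (c g)) * measure M B)" for g
  proof -
    have "emeasure M (A g) \<le> emeasure M (if g \<in> P then B else {}) + emeasure M (\<Union>p\<in>c g. \<phi> p ` B)"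
      unfolding A_def using cP[of g] pM B(1) by (intro emeasure_subadditive sets.finite_UN) auto
    also have "emeasure M (\<Union>p\<in>c g. \<phi> p ` B) = of_nat (card (c g)) * emeasure M B"
      using cP[of g] finP(2) disjoint_family_on_mono[OF cP(1) disj] B(1)
      by (intro measure_UN_translates) auto
    also have "emeasure M (if g \<in> P then B else {}) + of_nat (card (c g)) * emeasure M B
        = ennreal (((if g \<in> P then 1 else 0) + card (c g)) * measure M B)"
      by (auto simp: emeasure_eq_measure ennreal_of_nat_eq_real_of_nat distrib_right
          ennreal_mult[symmetric] ennreal_plus[symmetric] simp del: ennreal_plus)
    finally show ?thesis .
  qed
  have "(\<integral>\<^sup>+g. emeasure M (A g) \<partial>count_space (carrier G)) = (\<Sum>g\<in>P \<union> S. emeasure M (A g))"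
    using finP S by (intro nn_integral_count_space') (auto simp: A_def c_def)
  also have "\<dots> \<le> (\<Sum>g\<in>P \<union> S. ennreal (((if g \<in> P then 1 else 0) + card (c g)) * measure M B))"
    by (intro sum_mono eA)
  also have "\<dots> = ennreal (\<Sum>g\<in>P \<union> S. ((if g \<in> P then 1 else 0) + card (c g)) * measure M B)"
    by (intro sum_ennreal) auto
  also have "(\<Sum>g\<in>P \<union> S. ((if g \<in> P then 1 else 0) + card (c g)) * measure M B)
      = (real (card P) + (\<Sum>g\<in>S. card (c g))) * measure M B"
  proof -
    have "(\<Sum>g\<in>P \<union> S. if g \<in> P then 1 else 0 :: nat) = card P"
      using finP(1) S(1) by (simp add: sum.If_cases Int_absorb1)
    moreover have "(\<Sum>g\<in>P \<union> S. card (c g)) = (\<Sum>g\<in>S. card (c g))"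
      using finP(1) S(1) by (intro sum.mono_neutral_right) (auto simp: c_def)
    ultimately have "(\<Sum>g\<in>P \<union> S. (if g \<in> P then 1 else 0) + card (c g)) = card P + (\<Sum>g\<in>S. card (c g))"
      by (simp add: sum.distrib)
    then show ?thesis by (simp flip: sum_distrib_right of_nat_add of_nat_sum)
  qed
  also have "(\<Sum>g\<in>S. card (c g)) = (\<Sum>s\<in>S. card {p\<in>P. s \<otimes> p \<notin> F})"
    by (intro sum.cong) (auto simp: c_def)
  also have "ennreal ((real (card P) + (\<Sum>s\<in>S. card {p\<in>P. s \<otimes> p \<notin> F})) * measure M B)
      \<le> ennreal ((1 + e) * (card P * measure M B))"
    using mult_right_mono[OF bd, of "measure M B"] by (intro ennreal_leI) (simp add: algebra_simps)
  also have "\<dots> = ennreal (1 + e) * emeasure M (Y - (Y - W))"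
    unfolding YW eW using e by (simp add: ennreal_mult)
  finally have cost: "(\<integral>\<^sup>+g. emeasure M (A g) \<partial>count_space (carrier G))
    \<le> ennreal (1 + e) * emeasure M (Y - (Y - W))" .
  have con: "(x, \<phi> s x) \<in> connected_by A" if s: "s \<in> S" and x: "x \<in> W" "\<phi> s x \<in> Y" for s x
  proof -
    obtain p b where p: "p \<in> P" "b \<in> B" "x = \<phi> p b" using x(1) by (auto simp: W_def)
    have c: "p \<in> carrier G" "s \<in> carrier G" "b \<in> space M" using p s S finP Bs by auto
    have sx: "\<phi> s x = \<phi> (s \<otimes> p) b" using c p(3) by (simp add: act_mult)
    show ?thesis
    proof (cases "s \<otimes> p \<in> F")
      case True
      then have "s \<otimes> p \<in> P" using PY[OF p(2)] x(2) sx by simp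
      then have "(b, \<phi> s x) \<in> connected_by A"
        unfolding sx using c p by (intro connected_by_edge) (auto simp: A_def)
      moreover have "(b, x) \<in> connected_by A"
        unfolding p(3) using c p by (intro connected_by_edge) (auto simp: A_def)
      ultimately show ?thesis using connected_by_sym connected_by_trans by blast
    next
      case False
      then show ?thesis using c p s by (intro connected_by_edge) (auto simp: A_def c_def)
    qed
  qed
  have "(x, \<phi> s x) \<in> connected_by A"
    if s: "s \<in> S" and x: "x \<in> Y" "\<phi> s x \<in> Y" "\<not> (x \<in> Y - W \<and> \<phi> s x \<in> Y - W)" for s x
  proof (cases "x \<in> W")
    case False
    have "inv s \<in> S" using s S(4) by (auto simp: set_inv_eq_image)
    moreover have "\<phi> (inv s) (\<phi> s x) = x" using s S(2) x(1) Ys by (intro act_inv) auto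
    ultimately have "(\<phi> s x, x) \<in> connected_by A" using con[of "inv s" "\<phi> s x"] x False by auto
    then show ?thesis by (rule connected_by_sym)
  qed (use con s x in auto)
  then have "cheaply_connects S e Y (Y - W)"
    unfolding cheaply_connects_def using Y(1) WM AM cost by (intro conjI exI[of _ A]) auto
  then show ?thesis using less by blast
qed

lemma cheaply_connects_exhaust:
  assumes am: "amenable G" and S: "finite S" "S \<subseteq> carrier G" "\<one> \<in> S" "set_inv S = S" and e: "0 < e"
  shows "\<exists>Y. cheaply_connects S e (space M) Y \<and> measure M Y = 0"
proof (rule exhaustion)
  show "cheaply_connects S e Y Y" if "Y \<in> sets M" for Y
    using that by (auto simp: cheaply_connects_def intro!: exI[of _ "\<lambda>_. {}"])
  show "Z \<in> sets M \<and> Z \<subseteq> Y" if "cheaply_connects S e Y Z" for Y Z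
    using that by (simp add: cheaply_connects_def)
  show "\<exists>Z. cheaply_connects S e Y Z \<and> measure M Z < measure M Y"
    if "cheaply_connects S e (space M) Y" "0 < measure M Y" for Y
    using cheaply_connects_tile[OF am S e] that by (simp add: cheaply_connects_def)
next
  fix Y :: "nat \<Rightarrow> 'x set" assume step: "\<And>n. cheaply_connects S e (Y n) (Y (Suc n))"
  have YM: "Y n \<in> sets M" and Ydec: "Y (Suc n) \<subseteq> Y n" for n
    using step[of n] by (auto simp: cheaply_connects_def)
  have "\<exists>A. (\<forall>g\<in>carrier G. A g \<in> sets M) \<and>
      (\<integral>\<^sup>+g. emeasure M (A g) \<partial>count_space (carrier G)) \<le> ennreal (1 + e) * emeasure M (Y n - Y (Suc n)) \<and>
      (\<forall>s\<in>S. \<forall>x\<in>Y n. \<phi> s x \<in> Y n \<longrightarrow>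
        (x \<in> Y (Suc n) \<and> \<phi> s x \<in> Y (Suc n)) \<or> (x, \<phi> s x) \<in> connected_by A)" for n
    using step[of n] by (simp add: cheaply_connects_def)
  then obtain A where AM: "\<And>n g. g \<in> carrier G \<Longrightarrow> A n g \<in> sets M"
    and Acost: "\<And>n. (\<integral>\<^sup>+g. emeasure M (A n g) \<partial>count_space (carrier G))
      \<le> ennreal (1 + e) * emeasure M (Y n - Y (Suc n))"
    and Acon: "\<And>n s x. s \<in> S \<Longrightarrow> x \<in> Y n \<Longrightarrow> \<phi> s x \<in> Y n \<Longrightarrow>
      (x \<in> Y (Suc n) \<and> \<phi> s x \<in> Y (Suc n)) \<or> (x, \<phi> s x) \<in> connected_by (A n)"
    by metis
  define U where "U = (\<lambda>g. \<Union>n. A n g)"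
  have "(\<integral>\<^sup>+g. emeasure M (U g) \<partial>count_space (carrier G))
      \<le> (\<integral>\<^sup>+g. (\<Sum>n. emeasure M (A n g)) \<partial>count_space (carrier G))"
    using AM unfolding U_def by (intro nn_integral_mono emeasure_subadditive_countably) auto
  also have "\<dots> = (\<Sum>n. \<integral>\<^sup>+g. emeasure M (A n g) \<partial>count_space (carrier G))"
    by (intro nn_integral_suminf) auto
  also have "\<dots> \<le> (\<Sum>n. ennreal (1 + e) * emeasure M (Y n - Y (Suc n)))"
    by (intro suminf_le Acost) auto
  also have "\<dots> = ennreal (1 + e) * emeasure M (Y 0 - (\<Inter>n. Y n))"
    using emeasure_decrement_sum[of Y M] YM Ydec by simp
  finally have cost: "(\<integral>\<^sup>+g. emeasure M (U g) \<partial>count_space (carrier G))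
      \<le> ennreal (1 + e) * emeasure M (Y 0 - (\<Inter>n. Y n))" .
  have con: "(x, \<phi> s x) \<in> connected_by U"
    if s: "s \<in> S" and x: "x \<in> Y 0" "\<phi> s x \<in> Y 0" "\<not> (x \<in> (\<Inter>n. Y n) \<and> \<phi> s x \<in> (\<Inter>n. Y n))" for s x
  proof -
    have "\<exists>n. x \<in> Y n \<and> \<phi> s x \<in> Y n \<and> \<not> (x \<in> Y (Suc n) \<and> \<phi> s x \<in> Y (Suc n))"
    proof (rule ccontr)
      assume neg: "\<not> ?thesis"
      have "x \<in> Y n \<and> \<phi> s x \<in> Y n" for n by (induction n) (use x neg in auto)
      then show False using x(3) by blast
    qed
    then obtain n where "(x, \<phi> s x) \<in> connected_by (A n)" using Acon[OF s] by blast
    moreover have "connected_by (A n) \<subseteq> connected_by U"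
      by (rule connected_by_mono) (auto simp: U_def)
    ultimately show ?thesis by blast
  qed
  have UM: "\<forall>g\<in>carrier G. U g \<in> sets M" using AM by (auto simp: U_def)
  have "\<forall>s\<in>S. \<forall>x\<in>Y 0. \<phi> s x \<in> Y 0 \<longrightarrow>
      (x \<in> (\<Inter>n. Y n) \<and> \<phi> s x \<in> (\<Inter>n. Y n)) \<or> (x, \<phi> s x) \<in> connected_by U"
    using con by blast
  moreover have "(\<Inter>n. Y n) \<in> sets M" "(\<Inter>n. Y n) \<subseteq> Y 0" using YM by auto
  ultimately show "cheaply_connects S e (Y 0) (\<Inter>n. Y n)"
    unfolding cheaply_connects_def using YM[of 0] UM cost by (intro conjI exI[of _ U]) assumption+
qed

text \<open>
  After the exhaustion, all edges given by \<open>S\<close> are connected unless both ends lie in a null set. Off the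
  saturation of this null set, each orbit is therefore connected, since \<open>S\<close> generates the group.
\<close>

lemma cost_le_1:
  assumes inf: "infinite (carrier G)" and am: "amenable G"
    and S: "finite S" "S \<subseteq> carrier G" "\<one> \<in> S" "set_inv S = S" "generate G S = carrier G"
  shows "cost M (orbit_relation G M \<phi>) \<le> 1"
proof (rule ennreal_le_epsilon)
  fix e :: real assume e: "0 < e"
  let ?R = "orbit_relation G M \<phi>"
  obtain Y where Y: "cheaply_connects S e (space M) Y" "measure M Y = 0"
    using cheaply_connects_exhaust[OF am S(1-4) e] by blast
  have YM: "Y \<in> sets M" using Y by (simp add: cheaply_connects_def)
  obtain A where AM: "\<And>g. g \<in> carrier G \<Longrightarrow> A g \<in> sets M"
    and Acost: "(\<integral>\<^sup>+g. emeasure M (A g) \<partial>count_space (carrier G)) \<le> ennreal (1 + e) * emeasure M (space M - Y)"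
    and Acon: "\<And>s x. s \<in> S \<Longrightarrow> x \<in> space M \<Longrightarrow> \<phi> s x \<in> space M \<Longrightarrow>
      (x \<in> Y \<and> \<phi> s x \<in> Y) \<or> (x, \<phi> s x) \<in> connected_by A"
    using Y(1) unfolding cheaply_connects_def by blast
  define en where "en = from_nat_into (carrier G)"
  have en: "bij_betw en UNIV (carrier G)"
    unfolding en_def using countable_group inf by (rule bij_betw_from_nat_into)
  have enc: "en n \<in> carrier G" for n using en by (auto simp: bij_betw_def)
  define \<Phi> where "\<Phi> = \<lparr>index = UNIV, source = (\<lambda>n. A (en n)), target = (\<lambda>n. \<phi> (en n) ` A (en n)),
    pmap = (\<lambda>n. \<phi> (en n))\<rparr>"
  have As: "A g \<subseteq> space M" if "g \<in> carrier G" for g using AM[OF that] by (rule sets.sets_into_space)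
  have gr: "graphing M ?R \<Phi>"
    unfolding graphing_def
  proof (intro ballI conjI)
    fix i
    show "measure_preserving_iso M (source \<Phi> i) (target \<Phi> i) (pmap \<Phi> i)"
      using measure_preserving_iso_act[OF enc AM[OF enc]] by (simp add: \<Phi>_def)
    fix x assume "x \<in> source \<Phi> i"
    then show "(x, pmap \<Phi> i x) \<in> ?R"
      using enc[of i] As[OF enc] by (auto simp: \<Phi>_def orbit_relation_def orbit_def)
  qed
  have "graphing_edges \<Phi> = {(x, \<phi> g x) | g x. g \<in> carrier G \<and> x \<in> A g}"
  proof -
    have "\<exists>n. g = en n" if "g \<in> carrier G" for g using en that by (auto simp: bij_betw_def)
    then show ?thesis using enc unfolding graphing_edges_def \<Phi>_def by auto blast
  qed
  then have comp: "graphing_component \<Phi> x = connected_by A `` {x}" for x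
    by (simp add: graphing_component_def connected_by_def Let_def)
  have sound: "y \<in> ?R `` {x}" if x: "x \<in> space M" and xy: "(x, y) \<in> connected_by A" for x y
    using xy unfolding connected_by_def Let_def
  proof (induction rule: rtrancl_induct)
    case base
    then show ?case using x by (auto simp: orbit_relation_def orbit_def intro: exI[of _ \<one>])
  next
    case (step y z)
    then obtain g where g: "g \<in> carrier G" "y = \<phi> g x" by (auto simp: orbit_relation_def orbit_def)
    have ys: "y \<in> space M" using g x by simp
    obtain h where h: "h \<in> carrier G" "z = \<phi> h y"
    proof -
      from step(2) consider h where "h \<in> carrier G" "y \<in> A h" "z = \<phi> h y"
        | h where "h \<in> carrier G" "z \<in> A h" "y = \<phi> h z" by auto
      then show thesis
      proof cases
        case 2
        then have "z = \<phi> (inv h) y" using As by (auto simp: subset_iff)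
        then show thesis using 2 that by auto
      qed (use that in auto)
    qed
    have "z = \<phi> (h \<otimes> g) x" using g h x by (simp add: act_mult)
    then show ?case using g h x by (auto simp: orbit_relation_def orbit_def)
  qed
  define N where "N = (\<Union>g\<in>carrier G. \<phi> g ` Y)"
  have Ys: "Y \<subseteq> space M" using YM by (rule sets.sets_into_space)
  have Nnull: "N \<in> null_sets M"
    unfolding N_def using act_image[OF _ YM] Y(2)
    by (intro null_sets_UN' countable_group) (auto simp: null_sets_def emeasure_eq_measure)
  have full: "(x, \<phi> g x) \<in> connected_by A" if x: "x \<in> space M - N" and g: "g \<in> carrier G" for x g
  proof -
    have off: "\<phi> h x \<notin> Y" if h: "h \<in> carrier G" for h
    proof
      assume "\<phi> h x \<in> Y"
      then have "x \<in> \<phi> (inv h) ` Y" using h x by (intro image_eqI[of _ _ "\<phi> h x"]) auto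
      then show False using x h by (auto simp: N_def)
    qed
    have edge: "(\<phi> h x, \<phi> s (\<phi> h x)) \<in> connected_by A" if "s \<in> S" "h \<in> carrier G" for s h
      using Acon[of s "\<phi> h x"] off[of h] that x S(2) by auto
    \<comment> \<open>The statement is uniform in the starting point \<open>\<phi> k x\<close>, so that paths for two factors can be
      concatenated.\<close>
    have "\<forall>k\<in>carrier G. (\<phi> k x, \<phi> (h \<otimes> k) x) \<in> connected_by A" if "h \<in> generate G S" for h
      using that
    proof induction
      case one
      then show ?case by (auto simp: connected_by_def Let_def)
    next
      case (incl s)
      then show ?case using edge S(2) x by (auto simp: act_mult subset_iff)
    next
      case (inv s)
      then have "inv s \<in> S" using S(4) by (auto simp: set_inv_eq_image)
      then show ?case using edge S(2) x by (auto simp: act_mult subset_iff)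
    next
      case (eng a b)
      have c: "a \<in> carrier G" "b \<in> carrier G" using eng S(5) by auto
      show ?case
      proof
        fix k assume k: "k \<in> carrier G"
        have "(\<phi> k x, \<phi> (b \<otimes> k) x) \<in> connected_by A" using eng k by blast
        moreover have "(\<phi> (b \<otimes> k) x, \<phi> (a \<otimes> (b \<otimes> k)) x) \<in> connected_by A" using eng k c by blast
        ultimately show "(\<phi> k x, \<phi> (a \<otimes> b \<otimes> k) x) \<in> connected_by A"
          using connected_by_trans m_assoc c k by metis
      qed
    qed
    then have "(\<phi> \<one> x, \<phi> (g \<otimes> \<one>) x) \<in> connected_by A" using g S(5) by blast
    then show ?thesis using g x by simp
  qed
  have "generates M ?R \<Phi>"
    unfolding generates_def
    using AE_not_in[OF Nnull] AE_space
  proof eventually_elim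
    case (elim x)
    have "?R `` {x} \<subseteq> connected_by A `` {x}"
      using full[of x] elim by (auto simp: orbit_relation_def orbit_def)
    moreover have "connected_by A `` {x} \<subseteq> ?R `` {x}" using sound elim by blast
    ultimately show ?case by (simp add: comp)
  qed
  then have "cost M ?R \<le> graphing_cost M \<Phi>"
    unfolding cost_def using gr by (intro Inf_lower) auto
  also have "graphing_cost M \<Phi> = (\<integral>\<^sup>+n. emeasure M (A (en n)) \<partial>count_space UNIV)"
    by (simp add: graphing_cost_def \<Phi>_def infsum_ennreal_eq_suminf nn_integral_count_space_nat)
  also have "\<dots> = (\<integral>\<^sup>+g. emeasure M (A g) \<partial>count_space (carrier G))"
    by (rule nn_integral_bij_count_space[OF en])
  also have "\<dots> \<le> ennreal (1 + e) * emeasure M (space M - Y)" by (rule Acost)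
  also have "\<dots> \<le> ennreal (1 + e) * 1" by (intro mult_left_mono emeasure_le_1) auto
  also have "\<dots> = 1 + ennreal e" using e by simp
  finally show "cost M ?R \<le> 1 + ennreal e" .
qed

end

section \<open>Amenable groups have fixed price one\<close>

theorem corollary1p9:
  fixes \<Gamma> :: "('g, 'b) monoid_scheme" and S :: "'g set"
  assumes "group \<Gamma>"
    and "infinite (carrier \<Gamma>)"
    and "amenable \<Gamma>"
    and "S \<subseteq> carrier \<Gamma>"
    and "finite S"
    and "set_inv\<^bsub>\<Gamma>\<^esub> S = S"
    and "generate \<Gamma> S = carrier \<Gamma>"
    and "\<one>\<^bsub>\<Gamma>\<^esub> \<in> S"
  shows "(\<exists>F :: nat \<Rightarrow> 'g set.
            (\<forall>n. F n \<subseteq> carrier \<Gamma> \<and> finite (F n) \<and> \<one>\<^bsub>\<Gamma>\<^esub> \<in> F n) \<and>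
            (\<lambda>n. real (card (F n <#>\<^bsub>\<Gamma>\<^esub> S <#>\<^bsub>\<Gamma>\<^esub> set_inv\<^bsub>\<Gamma>\<^esub> (F n))) / (real (card (F n)))\<^sup>2)
              \<longlonglongrightarrow> 0) \<and>
         fixed_price_one TYPE('x) \<Gamma>"
proof (intro conjI)
  show "\<exists>F :: nat \<Rightarrow> 'g set.
      (\<forall>n. F n \<subseteq> carrier \<Gamma> \<and> finite (F n) \<and> \<one>\<^bsub>\<Gamma>\<^esub> \<in> F n) \<and>
      (\<lambda>n. real (card (F n <#>\<^bsub>\<Gamma>\<^esub> S <#>\<^bsub>\<Gamma>\<^esub> set_inv\<^bsub>\<Gamma>\<^esub> (F n))) / (real (card (F n)))\<^sup>2)
        \<longlonglongrightarrow> 0"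
    by (rule group.amenable_sandwich_ratio[OF assms(1-3) assms(5,4,8)]) blast
  have countable: "countable (carrier \<Gamma>)"
    using group.countable_generate[OF assms(1) countable_finite[OF assms(5)] assms(4,6)] assms(7) by simp
  show "fixed_price_one TYPE('x) \<Gamma>"
    unfolding fixed_price_one_def
  proof (intro conjI allI impI countable)
    fix M :: "'x measure" and \<phi>
    assume "standard_prob_space M \<and> pmp_action \<Gamma> M \<phi> \<and> essentially_free \<Gamma> M \<phi>"
    then interpret free_pmp_action \<Gamma> M \<phi>
      using assms(1) countable by (simp add: free_pmp_action_def free_pmp_action_axioms_def)
    show "cost M (orbit_relation \<Gamma> M \<phi>) = 1"
      using cost_le_1[OF assms(2,3,5,4,8,6,7)] cost_ge_1[OF assms(2)] by (rule antisym)
  qed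
qed

end
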